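(* Let $f(n,p,q)$ denote the minimum number of colors in an edge-coloring of $K_n$ such that every $p$-clique contains edges of at least $q$ distinct colors. Then, as $n \to \infty$, \[ f(n,6,6) \leq n^{1/3 + o(1)} \quad\text{and}\quad f(n,8,8) \leq n^{1/4+o(1)}. \] *)

theory Defs
  imports Complex_Main
begin

definition Kedges :: "nat \<Rightarrow> nat set set" where
  "Kedges n = {e. e \<subseteq> {..<n} \<and> card e = 2}"

definition good_colouring :: "nat \<Rightarrow> nat \<Rightarrow> nat \<Rightarrow> nat \<Rightarrow> (nat set \<Rightarrow> nat) \<Rightarrow> bool" where
  "good_colouring n p q k c \<longleftrightarrow>
     (\<forall>e\<in>Kedges n. c e < k) \<and>
     (\<forall>S. S \<subseteq> {..<n} \<and> card S = p \<longrightarrow> card (c ` {e. e \<subseteq> S \<and> card e = 2}) \<ge> q)"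

definition EG :: "nat \<Rightarrow> nat \<Rightarrow> nat \<Rightarrow> nat" where
  "EG n p q = (LEAST k. \<exists>c. good_colouring n p q k c)"

end

theory Submission
  imports Defs "HOL-Analysis.Cartesian_Space" "HOL-Algebra.Algebraic_Closure_Type" "HOL-Library.Z2"
begin

no_notation fps_nth (infixl \<open>$\<close> 75)

text \<open>
  Two colourings are multiplied. The first, with $n^{o(1)}$ colours, iterates a block construction in
  the style of Mubayi and of Conlon, Fox, Lee and Sudakov: every set of at most eight vertices
  with fewer colours than vertices is a binary tree, that is, it is split into two parts joined by a
  single colour, recursively, with all colours of the tree distinct and with the first part
  entirely below the second.

  The second takes vertices in $F^d$ ($d = 3, 4$) for a finite field $F$, and colours a pair by its
  dot product unless the pair is degenerate. If $A$ and $B$ are joined by one colour, the direction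
  spaces $\langle A - A \rangle$ and $\langle B - B \rangle$ are orthogonal, and a dimension count shows
  that a tree whose direction space has dimension $r \geq 1$ has at most $2r$ points. Orthogonality
  at the root costs one more dimension, so no tree has $2d$ points. Isotropic vectors are the only
  obstacle to the count; for them the dot product is replaced by the first coordinate of a
  difference, which separates the parts, and for $d \leq 4$ the direction spaces of the two parts
  meet in dimension at most one.

  The fields are the subfields of order $2^k$ of the algebraic closure of the field with two elements.
\<close>

section \<open>Orthogonality over an arbitrary field\<close>

definition dot :: "'a::field ^ 'n \<Rightarrow> 'a ^ 'n \<Rightarrow> 'a" where
  "dot x y = (\<Sum>i\<in>UNIV. x $ i * y $ i)"

lemma dot_commute: "dot x y = dot y x"
  by (simp add: dot_def mult.commute)

lemma dot_add_right: "dot x (y + z) = dot x y + dot x z"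
  by (simp add: dot_def distrib_left sum.distrib)

lemma dot_diff_right: "dot x (y - z) = dot x y - dot x z"
  by (simp add: dot_def right_diff_distrib sum_subtractf)

lemma dot_scale_right: "dot x (c *s y) = c * dot x y"
  by (simp add: dot_def sum_distrib_left algebra_simps)

lemma dot_zero_right [simp]: "dot x 0 = 0"
  by (simp add: dot_def)

lemma dot_axis: "dot (axis i 1) y = y $ i"
  by (simp add: dot_def axis_def if_distrib[of "\<lambda>c. c * _"] cong: if_cong)

lemma subspace_perp: "vec.subspace {y. dot x y = 0}"
  by (auto simp: vec.subspace_def dot_add_right dot_scale_right)

lemma dot_eq_0_span:
  assumes "\<And>a w. a \<in> A \<Longrightarrow> w \<in> W \<Longrightarrow> dot a w = 0" and "a \<in> vec.span A" "w \<in> vec.span W"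
  shows "dot a w = 0"
proof -
  have "dot a w = 0" if "a \<in> A" for a
    using vec.span_minimal[OF _ subspace_perp[of a], of W] assms(1)[OF that] assms(3) by blast
  then show ?thesis
    using vec.span_minimal[OF _ subspace_perp[of w], of A] assms(2) by (auto simp: dot_commute)
qed

text \<open>Extend a basis \<open>B\<close> of the span of \<open>U\<close> to a basis
  \<open>B'\<close> of the whole space. The dot product is nondegenerate, so taking dot products
  with all members of \<open>B'\<close> is injective, and it sends \<open>W\<close> to vectors that
  vanish at the positions of \<open>B\<close>. Nothing is assumed about isotropic vectors: the spans
  of \<open>U\<close> and \<open>W\<close> may meet.\<close>

lemma dim_add_dim_le_if_perp:
  fixes U W :: "('a::field ^ 'n) set"
  assumes perp: "\<And>u w. u \<in> U \<Longrightarrow> w \<in> W \<Longrightarrow> dot u w = 0"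
  shows "vec.dim U + vec.dim W \<le> CARD('n)"
proof -
  obtain B where B: "B \<subseteq> U" "vec.independent B" "U \<subseteq> vec.span B" "card B = vec.dim U"
    by (rule vec.basis_exists)
  define B' where "B' = vec.extend_basis B"
  have B': "B \<subseteq> B'" "vec.independent B'" "vec.span B' = UNIV"
    unfolding B'_def using B(2)
    by (simp_all add: vec.extend_basis_superset vec.independent_extend_basis)
  have fin: "finite B'" using B'(2) by (rule vec.finiteI_independent)
  have "card B' = CARD('n)"
  proof -
    have "vec.dim B' = card B'" by (rule vec.dim_eq_card_independent[OF B'(2)])
    then have "card B' = vec.dim (vec.span B')" by simp
    then show ?thesis by (simp only: B'(3) vec_dim_card)
  qed
  then obtain g :: "'n \<Rightarrow> _" where g: "bij_betw g UNIV B'"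
    using finite_same_card_bij[OF finite[of UNIV] fin] by auto
  define f where "f w = (\<chi> i. dot (g i) w)" for w
  have lin: "Vector_Spaces.linear (*s) (*s) f"
    by unfold_locales (auto simp: f_def vec_eq_iff dot_add_right dot_scale_right algebra_simps)
  have inj: "inj f"
  proof (subst vec.linear_inj_iff_eq_0[OF lin], intro allI impI)
    fix w assume "f w = 0"
    then have "dot (g i) w = 0" for i by (simp add: f_def vec_eq_iff)
    then have "\<And>b. b \<in> B' \<Longrightarrow> dot b w = 0"
      using g by (metis bij_betw_imp_surj_on imageE)
    then have "dot x w = 0" for x
      using dot_eq_0_span[of B' "{w}" x w] B'(3) by (auto intro: vec.span_base)
    then have "w $ i = 0" for i using dot_axis[of i w] by simp
    then show "w = 0" by (simp add: vec_eq_iff)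
  qed
  define d where "d = {i. g i \<notin> B}"
  have "f ` W \<subseteq> {x. \<forall>i. i \<notin> d \<longrightarrow> x $ i = 0}"
    using perp B(1) by (auto simp: f_def d_def)
  from vec.dim_subset[OF this] have "vec.dim (f ` W) \<le> card d"
    by (simp only: dim_substandard_cart)
  moreover have "vec.dim (f ` W) = vec.dim W"
    by (rule vec.dim_image_eq[OF lin inj_on_subset[OF inj subset_UNIV]])
  moreover have "card (- d) = card B"
  proof -
    have "bij_betw g (- d) B"
    proof (rule bij_betw_imageI)
      show "inj_on g (- d)" using g by (auto simp: bij_betw_def inj_on_def)
      have "B \<subseteq> range g" using g B'(1) by (simp add: bij_betw_def)
      then show "g ` (- d) = B" by (auto simp: d_def)
    qed
    then show ?thesis by (rule bij_betw_same_card)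
  qed
  ultimately show ?thesis
    using B(4) card_Un_disjoint[of d "- d"] by simp
qed

section \<open>Direction spaces of affine hulls\<close>

definition dirs :: "('a::field ^ 'n) set \<Rightarrow> ('a ^ 'n) set" where
  "dirs A = vec.span {x - y | x y. x \<in> A \<and> y \<in> A}"

lemma diff_in_dirs: "x \<in> A \<Longrightarrow> y \<in> A \<Longrightarrow> x - y \<in> dirs A"
  unfolding dirs_def by (rule vec.span_base) auto

lemma subspace_dirs [simp]: "vec.subspace (dirs A)"
  by (simp add: dirs_def)

lemma dirs_minimal:
  "vec.subspace U \<Longrightarrow> (\<And>x y. x \<in> A \<Longrightarrow> y \<in> A \<Longrightarrow> x - y \<in> U) \<Longrightarrow> dirs A \<subseteq> U"
  unfolding dirs_def by (rule vec.span_minimal) auto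

lemma dirs_mono: "A \<subseteq> B \<Longrightarrow> dirs A \<subseteq> dirs B"
  unfolding dirs_def by (rule vec.span_mono) auto

lemma dot_eq_0_dirs:
  assumes "\<And>x y. x \<in> A \<Longrightarrow> y \<in> A \<Longrightarrow> dot a x = dot a y" and "w \<in> dirs A"
  shows "dot a w = 0"
proof -
  have "dirs A \<subseteq> {y. dot a y = 0}"
  proof (rule dirs_minimal[OF subspace_perp])
    fix x y assume "x \<in> A" "y \<in> A"
    then have "dot a x = dot a y" by (rule assms(1))
    then show "x - y \<in> {y. dot a y = 0}" by (simp add: dot_diff_right)
  qed
  then show ?thesis using assms(2) by blast
qed

lemma subspace_kernel_coord: "vec.subspace {y. y $ j = 0}"
  by (auto simp: vec.subspace_def)

lemma coord_eq_0_dirs: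
  fixes A :: "('a::field ^ 'n) set"
  assumes "\<And>x y. x \<in> A \<Longrightarrow> y \<in> A \<Longrightarrow> x $ j = y $ j" and "w \<in> dirs A"
  shows "w $ j = 0"
proof -
  have "dirs A \<subseteq> {y. y $ j = 0}"
  proof (rule dirs_minimal[OF subspace_kernel_coord])
    fix x y assume "x \<in> A" "y \<in> A"
    then have "x $ j = y $ j" by (rule assms(1))
    then show "x - y \<in> {y. y $ j = 0}" by simp
  qed
  then show ?thesis using assms(2) by blast
qed

section \<open>The algebraic colouring\<close>

text \<open>A constant value on $A \times B$ keeps coordinate \<open>i0\<close> constant on each of $A$ and $B$, and supplies
  a coordinate functional that is constant on both with different values.\<close>

definition sep_col :: "'n \<Rightarrow> 'a::field ^ 'n \<Rightarrow> 'a ^ 'n \<Rightarrow> 'n \<times> 'a" where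
  "sep_col i0 x y = (let j = if x $ i0 \<noteq> y $ i0 then i0 else SOME j. x $ j \<noteq> y $ j in (j, y $ j - x $ j))"

lemma sep_colD:
  assumes "sep_col i0 x y = (j, c)" "x \<noteq> y"
  shows "y $ j - x $ j = c" "c \<noteq> 0" "j \<noteq> i0 \<Longrightarrow> x $ i0 = y $ i0"
proof -
  have "\<exists>j. x $ j \<noteq> y $ j" using assms(2) by (simp add: vec_eq_iff)
  then have "x $ (SOME j. x $ j \<noteq> y $ j) \<noteq> y $ (SOME j. x $ j \<noteq> y $ j)" by (rule someI_ex)
  then show "y $ j - x $ j = c" "c \<noteq> 0" "j \<noteq> i0 \<Longrightarrow> x $ i0 = y $ i0"
    using assms(1) by (auto simp: sep_col_def Let_def split: if_splits)
qed

lemma sep_col_const: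
  fixes A B :: "('a::field ^ 'n) set"
  assumes disj: "A \<inter> B = {}" and ne: "A \<noteq> {}" "B \<noteq> {}"
    and const: "\<And>a b. a \<in> A \<Longrightarrow> b \<in> B \<Longrightarrow> sep_col i0 a b = g"
  shows "x \<in> A \<Longrightarrow> x' \<in> A \<Longrightarrow> x $ i0 = x' $ i0"
    and "y \<in> B \<Longrightarrow> y' \<in> B \<Longrightarrow> y $ i0 = y' $ i0"
    and "a \<in> A \<Longrightarrow> b \<in> B \<Longrightarrow> u \<in> dirs A \<Longrightarrow> w \<in> dirs B \<Longrightarrow> b - a \<noteq> u + w"
proof -
  obtain j c where g: "g = (j, c)" by fastforce
  have K: "b $ j - a $ j = c" "c \<noteq> 0" "j \<noteq> i0 \<Longrightarrow> a $ i0 = b $ i0" if "a \<in> A" "b \<in> B" for a b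
    using sep_colD[OF const[OF that, unfolded g]] that disj by auto
  obtain a0 b0 where ab: "a0 \<in> A" "b0 \<in> B" using ne by auto
  have A: "x $ j = b0 $ j - c" if "x \<in> A" for x using K(1)[OF that ab(2)] by (simp add: algebra_simps)
  have B: "y $ j = a0 $ j + c" if "y \<in> B" for y using K(1)[OF ab(1) that] by (simp add: algebra_simps)
  show "x $ i0 = x' $ i0" if "x \<in> A" "x' \<in> A"
  proof (cases "j = i0")
    case True
    then show ?thesis using A[OF that(1)] A[OF that(2)] by simp
  next
    case False
    then show ?thesis using K(3)[OF that(1) ab(2)] K(3)[OF that(2) ab(2)] by simp
  qed
  show "y $ i0 = y' $ i0" if "y \<in> B" "y' \<in> B"
  proof (cases "j = i0")
    case True
    then show ?thesis using B[OF that(1)] B[OF that(2)] by simp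
  next
    case False
    then show ?thesis using K(3)[OF ab(1) that(1)] K(3)[OF ab(1) that(2)] by simp
  qed
  show "b - a \<noteq> u + w" if "a \<in> A" "b \<in> B" "u \<in> dirs A" "w \<in> dirs B"
  proof
    assume eq: "b - a = u + w"
    \<comment> \<open>Reading coordinate \<open>j\<close> is a linear functional that vanishes on
      both direction spaces but takes the nonzero value \<open>c\<close> on
      \<open>b - a\<close>.\<close>
    have "u $ j = 0" using coord_eq_0_dirs[of A j u] A that(3) by simp
    moreover have "w $ j = 0" using coord_eq_0_dirs[of B j w] B that(4) by simp
    ultimately have "(b - a) $ j = 0" by (simp add: eq)
    then show False using K(1,2)[OF that(1,2)] by simp
  qed
qed

text \<open>In the first three cases the value of the dot product is implied by the case itself, at least
  up to orthogonality of one part to the directions of the other, so the colour is free to carry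
  \<open>sep_col\<close> instead.\<close>

datatype ('a, 'n) alg_col = Up "'n \<times> 'a" | Down "'n \<times> 'a" | Zero "'n \<times> 'a" | Dot 'a

definition alg_col :: "'n \<Rightarrow> 'a::field ^ 'n \<Rightarrow> 'a ^ 'n \<Rightarrow> ('a, 'n) alg_col" where
  "alg_col i0 x y =
    (if dot x (y - x) = 0 then Up (sep_col i0 x y)
     else if dot y (y - x) = 0 then Down (sep_col i0 x y)
     else if dot x y = 0 then Zero (sep_col i0 x y)
     else Dot (dot x y))"

lemma dim_less_if_psubset:
  fixes U W :: "('a::field ^ 'n) set"
  shows "vec.subspace U \<Longrightarrow> vec.subspace W \<Longrightarrow> U \<subset> W \<Longrightarrow> vec.dim U < vec.dim W"
  using vec.subspace_dim_equal[of U W] by (auto simp: psubset_eq not_le[symmetric])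

text \<open>If equality held, \<open>A\<close> would lie in its own direction space.\<close>

lemma dim_dirs_add_lt:
  fixes A B :: "('a::field ^ 'n) set"
  assumes perp: "\<And>a w. a \<in> A \<Longrightarrow> w \<in> dirs B \<Longrightarrow> dot a w = 0" and "\<not> A \<subseteq> dirs A"
  shows "vec.dim (dirs A) + vec.dim (dirs B) < CARD('n)"
proof (rule ccontr)
  assume "\<not> ?thesis"
  moreover have "vec.dim A + vec.dim (dirs B) \<le> CARD('n)"
    by (rule dim_add_dim_le_if_perp) (rule perp)
  ultimately have le: "vec.dim (vec.span A) \<le> vec.dim (dirs A)" by simp
  have "dirs A \<subseteq> vec.span A"
    by (rule dirs_minimal) (auto intro: vec.span_diff vec.span_base)
  then have "dirs A = vec.span A"
    using vec.subspace_dim_equal[of "dirs A" "vec.span A"] le by simp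
  then show False using assms(2) vec.span_superset by auto
qed

text \<open>These are the two facts about a node that the tree count uses. In every case one part is
  orthogonal to the directions of the other and does not lie in its own direction space, so
  \<open>dim_dirs_add_lt\<close> applies. The second conclusion is a dichotomy: either
  \<open>sep_col\<close> is constant and separates the parts, or the colour is a \<open>Dot\<close>,
  and then orthogonality holds both ways while no difference \<open>b - a\<close> is orthogonal to
  an endpoint.\<close>

lemma alg_col_const:
  fixes A B :: "('a::field ^ 'n) set"
  assumes disj: "A \<inter> B = {}" and ne: "A \<noteq> {}" "B \<noteq> {}"
    and nz: "\<And>x. x \<in> A \<union> B \<Longrightarrow> x $ i0 \<noteq> 0"
    and const: "\<And>a b. a \<in> A \<Longrightarrow> b \<in> B \<Longrightarrow> alg_col i0 a b = g"
  shows "vec.dim (dirs A) + vec.dim (dirs B) < CARD('n)"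
    and "(\<forall>a\<in>A. \<forall>b\<in>B. \<forall>u\<in>dirs A. \<forall>w\<in>dirs B. b - a \<noteq> u + w) \<or>
      (\<forall>a\<in>A. \<forall>w\<in>dirs B. dot a w = 0) \<and> (\<forall>b\<in>B. \<forall>w\<in>dirs A. dot b w = 0) \<and>
      (\<forall>a\<in>A. \<forall>b\<in>B. dot a (b - a) \<noteq> 0 \<and> dot b (b - a) \<noteq> 0)"
proof -
  obtain a0 b0 where ab: "a0 \<in> A" "b0 \<in> B" using ne by auto
  \<comment> \<open>A coordinate that is constant on \<open>C\<close> vanishes on
    \<open>dirs C\<close>, but coordinate \<open>i0\<close> is nonzero at every point of
    \<open>C\<close>.\<close>
  have not_sub: "\<not> C \<subseteq> dirs C" if C: "\<And>x x'. x \<in> C \<Longrightarrow> x' \<in> C \<Longrightarrow> x $ i0 = x' $ i0" "C \<subseteq> A \<union> B" "C \<noteq> {}" for C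
  proof
    assume "C \<subseteq> dirs C"
    moreover obtain x where "x \<in> C" using C(3) by auto
    ultimately have "x $ i0 = 0" using coord_eq_0_dirs[of C i0 x] C(1) by blast
    then show False using nz \<open>x \<in> C\<close> C(2) by blast
  qed
  have lt: "vec.dim (dirs A) + vec.dim (dirs B) < CARD('n)"
    if "\<And>a b. a \<in> A \<Longrightarrow> b \<in> B \<Longrightarrow> sep_col i0 a b = k"
      "(\<forall>a\<in>A. \<forall>w\<in>dirs B. dot a w = 0) \<or> (\<forall>b\<in>B. \<forall>w\<in>dirs A. dot b w = 0)" for k
    using that(2)
  proof
    assume "\<forall>a\<in>A. \<forall>w\<in>dirs B. dot a w = 0"
    then show ?thesis
      using dim_dirs_add_lt[of A B] not_sub[of A] sep_col_const(1)[OF disj ne that(1)] ne by blast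
  next
    assume "\<forall>b\<in>B. \<forall>w\<in>dirs A. dot b w = 0"
    then show ?thesis
      using dim_dirs_add_lt[of B A] not_sub[of B] sep_col_const(2)[OF disj ne that(1)] ne
      by (subst add.commute) blast
  qed
  show "vec.dim (dirs A) + vec.dim (dirs B) < CARD('n)"
  proof (cases g)
    case (Up k)
    then have k: "sep_col i0 a b = k" "dot a b = dot a a" if "a \<in> A" "b \<in> B" for a b
      using const[OF that] by (auto simp: alg_col_def dot_diff_right split: if_splits)
    have "\<forall>a\<in>A. \<forall>w\<in>dirs B. dot a w = 0"
      by (intro ballI dot_eq_0_dirs[of B]) (simp_all add: k(2))
    then show ?thesis using lt[OF k(1)] by blast
  next
    case (Down k)
    then have k: "sep_col i0 a b = k" "dot b a = dot b b" if "a \<in> A" "b \<in> B" for a b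
      using const[OF that] by (auto simp: alg_col_def dot_diff_right split: if_splits)
    have "\<forall>b\<in>B. \<forall>w\<in>dirs A. dot b w = 0"
      by (intro ballI dot_eq_0_dirs[of A]) (simp_all add: k(2))
    then show ?thesis using lt[OF k(1)] by blast
  next
    case (Zero k)
    then have k: "sep_col i0 a b = k" "dot a b = 0" if "a \<in> A" "b \<in> B" for a b
      using const[OF that] by (auto simp: alg_col_def split: if_splits)
    have "\<forall>a\<in>A. \<forall>w\<in>dirs B. dot a w = 0"
      by (intro ballI dot_eq_0_dirs[of B]) (simp_all add: k(2))
    then show ?thesis using lt[OF k(1)] by blast
  next
    case (Dot c)
    then have k: "dot a b = c" "dot a b \<noteq> 0" if "a \<in> A" "b \<in> B" for a b
      using const[OF that] by (auto simp: alg_col_def split: if_splits)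
    \<comment> \<open>The functional \<open>dot b0\<close> now takes the place of coordinate
      \<open>i0\<close>: it vanishes on \<open>dirs A\<close> and has the nonzero value
      \<open>c\<close> on \<open>A\<close>.\<close>
    have "dot b0 w = 0" if "w \<in> dirs A" for w
      using dot_eq_0_dirs[of A b0 w] k(1) ab that by (simp add: dot_commute[of b0])
    then have "\<not> A \<subseteq> dirs A" using k(2)[OF ab] ab(1) by (auto simp: dot_commute[of b0])
    moreover have "dot a w = 0" if "a \<in> A" "w \<in> dirs B" for a w
      by (rule dot_eq_0_dirs[OF _ that(2)]) (simp add: k(1) that(1))
    ultimately show ?thesis by (rule dim_dirs_add_lt[rotated])
  qed
  show "(\<forall>a\<in>A. \<forall>b\<in>B. \<forall>u\<in>dirs A. \<forall>w\<in>dirs B. b - a \<noteq> u + w) \<or>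
      (\<forall>a\<in>A. \<forall>w\<in>dirs B. dot a w = 0) \<and> (\<forall>b\<in>B. \<forall>w\<in>dirs A. dot b w = 0) \<and>
      (\<forall>a\<in>A. \<forall>b\<in>B. dot a (b - a) \<noteq> 0 \<and> dot b (b - a) \<noteq> 0)"
  proof (cases "\<exists>k. \<forall>a\<in>A. \<forall>b\<in>B. sep_col i0 a b = k")
    case True
    then obtain k where "\<And>a b. a \<in> A \<Longrightarrow> b \<in> B \<Longrightarrow> sep_col i0 a b = k" by blast
    from sep_col_const(3)[OF disj ne this] show ?thesis by blast
  next
    case False
    \<comment> \<open>The other three constructors carry the value of \<open>sep_col\<close>, which
      would then be constant.\<close>
    have "\<exists>c. g = Dot c"
    proof (cases g)
      case (Up k)
      then have "sep_col i0 a b = k" if "a \<in> A" "b \<in> B" for a b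
        using const[OF that] by (auto simp: alg_col_def split: if_splits)
      then show ?thesis using False by blast
    next
      case (Down k)
      then have "sep_col i0 a b = k" if "a \<in> A" "b \<in> B" for a b
        using const[OF that] by (auto simp: alg_col_def split: if_splits)
      then show ?thesis using False by blast
    next
      case (Zero k)
      then have "sep_col i0 a b = k" if "a \<in> A" "b \<in> B" for a b
        using const[OF that] by (auto simp: alg_col_def split: if_splits)
      then show ?thesis using False by blast
    next
      case (Dot c)
      then show ?thesis by blast
    qed
    then obtain c where "g = Dot c" by blast
    then have k: "dot a b = c" "dot b a = c" "dot a (b - a) \<noteq> 0" "dot b (b - a) \<noteq> 0"
      if "a \<in> A" "b \<in> B" for a b
      using const[OF that] by (auto simp: alg_col_def dot_commute[of b] split: if_splits)
    have "\<forall>a\<in>A. \<forall>w\<in>dirs B. dot a w = 0"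
      by (intro ballI dot_eq_0_dirs[of B]) (simp_all add: k(1))
    moreover have "\<forall>b\<in>B. \<forall>w\<in>dirs A. dot b w = 0"
      by (intro ballI dot_eq_0_dirs[of A]) (simp_all add: k(2))
    ultimately show ?thesis using k(3,4) by blast
  qed
qed

text \<open>The dimension count needs only that the colour is constant across each split, so neither
  an order on the vertices nor distinct colours at distinct nodes are asked for.\<close>

inductive colour_tree :: "('v \<Rightarrow> 'v \<Rightarrow> 'c) \<Rightarrow> 'v set \<Rightarrow> bool" for h where
  leaf: "colour_tree h {x}"
| node: "colour_tree h A \<Longrightarrow> colour_tree h B \<Longrightarrow> A \<inter> B = {} \<Longrightarrow> (\<And>a b. a \<in> A \<Longrightarrow> b \<in> B \<Longrightarrow> h a b = g) \<Longrightarrow> colour_tree h (A \<union> B)"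

lemma colour_tree_finite: "colour_tree h A \<Longrightarrow> finite A \<and> A \<noteq> {}"
  by (induction rule: colour_tree.induct) auto

text \<open>Induction over the tree, with \<open>U\<close> the sum of the two direction spaces and
  \<open>i\<close> the dimension of their intersection, so that \<open>U\<close> has dimension
  \<open>rA + rB - i\<close>. If \<open>b - a\<close> lies outside \<open>U\<close>, it adds a
  dimension, which pays for \<open>i \<le> 1\<close> or, when a part is a single point, for that
  point. If \<open>b - a\<close> lies in \<open>U\<close>, orthogonality forces \<open>i = 0\<close>
  and both ranks to be positive. Either way the bounds for the parts add up.\<close>

lemma card_alg_col_tree_le:
  fixes A :: "('a::field ^ 'n) set"
  assumes "colour_tree (alg_col i0) A" "\<And>x. x \<in> A \<Longrightarrow> x $ i0 \<noteq> 0" "CARD('n) \<le> 4"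
  shows "card A \<le> max 1 (2 * vec.dim (dirs A))"
  using assms(1,2)
proof (induction rule: colour_tree.induct)
  case (leaf x)
  show ?case by simp
next
  case (node A B g)
  define rA where "rA = vec.dim (dirs A)"
  define rB where "rB = vec.dim (dirs B)"
  define i where "i = vec.dim (dirs A \<inter> dirs B)"
  define r where "r = vec.dim (dirs (A \<union> B))"
  define U where "U = {x + y |x y. x \<in> dirs A \<and> y \<in> dirs B}"
  have fin: "finite A" "A \<noteq> {}" "finite B" "B \<noteq> {}"
    using colour_tree_finite node.hyps by auto
  note cst = alg_col_const[OF node.hyps(3) fin(2,4) node.prems node.hyps(4)]
  have "card A \<le> max 1 (2 * rA)" "card B \<le> max 1 (2 * rB)"
    using node.IH node.prems by (simp_all add: rA_def rB_def)
  then have IH: "card A \<le> 2 * rA \<or> rA = 0 \<and> card A \<le> 1" "card B \<le> 2 * rB \<or> rB = 0 \<and> card B \<le> 1"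
    by linarith+
  have card: "card (A \<union> B) = card A + card B"
    using fin node.hyps(3) by (simp add: card_Un_disjoint)
  have lt: "rA + rB \<le> 3"
    using cst(1) assms(3) by (simp add: rA_def rB_def)
  have dimU: "vec.dim U + i = rA + rB"
    unfolding U_def i_def rA_def rB_def by (rule vec.dim_sums_Int) auto
  have iA: "i \<le> rA" and iB: "i \<le> rB"
    by (auto simp: i_def rA_def rB_def intro: vec.dim_subset)
  have subU: "vec.subspace U"
    unfolding U_def by (rule vec.subspace_sums) auto
  have Ur: "U \<subseteq> dirs (A \<union> B)"
    unfolding U_def using dirs_mono[of A "A \<union> B"] dirs_mono[of B "A \<union> B"]
    by (auto intro!: vec.subspace_add)
  obtain a b where ab: "a \<in> A" "b \<in> B" using fin by auto
  have bar: "b - a \<in> dirs (A \<union> B)" using ab by (intro diff_in_dirs) auto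
  have "card A + card B \<le> 2 * r"
  proof (cases "b - a \<in> U")
    case False
    have "U \<noteq> dirs (A \<union> B)" using False bar by auto
    then have "vec.dim U < r"
      unfolding r_def using dim_less_if_psubset[OF subU, of "dirs (A \<union> B)"] Ur by auto
    \<comment> \<open>The ranks sum to at most three, so the smaller one is at most one; this is
      where dimension at most four enters.\<close>
    moreover have "i \<le> 1" using iA iB lt by linarith
    ultimately show ?thesis using IH dimU iA iB by (elim disjE conjE) linarith+
  next
    case True
    then obtain u w where uw: "b - a = u + w" "u \<in> dirs A" "w \<in> dirs B"
      by (auto simp: U_def)
    have perp: "\<forall>a\<in>A. \<forall>w\<in>dirs B. dot a w = 0" "\<forall>b\<in>B. \<forall>w\<in>dirs A. dot b w = 0"
      and nz: "dot a (b - a) \<noteq> 0" "dot b (b - a) \<noteq> 0"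
      using cst(2) ab uw by blast+
    \<comment> \<open>Otherwise \<open>b - a = u + w\<close> would lie in \<open>dirs B\<close>, to
      which \<open>a\<close> is orthogonal, against \<open>nz\<close>.\<close>
    have "\<not> dirs A \<subseteq> dirs B"
      using bspec[OF perp(1) ab(1)] nz(1) uw by (auto simp: dot_add_right)
    then have "i < rA"
      unfolding i_def rA_def
      by (intro dim_less_if_psubset vec.subspace_inter subspace_dirs psubsetI) auto
    have "\<not> dirs B \<subseteq> dirs A"
      using bspec[OF perp(2) ab(2)] nz(2) uw by (auto simp: dot_add_right)
    then have "i < rB"
      unfolding i_def rB_def
      by (intro dim_less_if_psubset vec.subspace_inter subspace_dirs psubsetI) auto
    have "vec.dim U \<le> r" unfolding r_def by (rule vec.dim_subset[OF Ur])
    moreover have "i = 0" using \<open>i < rA\<close> \<open>i < rB\<close> lt by linarith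
    ultimately show ?thesis using IH dimU \<open>i < rA\<close> \<open>i < rB\<close> by (elim disjE conjE) linarith+
  qed
  then show ?case by (simp add: card r_def)
qed

text \<open>Applied to the whole tree, the previous bound would allow \<open>2 * CARD('n)\<close>
  points. Applied to the two parts at the root it gives less, because their ranks sum to at most
  \<open>CARD('n) - 1\<close> and a part of rank zero has only one point.\<close>

lemma card_alg_col_tree_lt:
  fixes A :: "('a::field ^ 'n) set"
  assumes "colour_tree (alg_col i0) A" "\<And>x. x \<in> A \<Longrightarrow> x $ i0 \<noteq> 0" "CARD('n) \<le> 4" "2 \<le> CARD('n)"
  shows "card A < 2 * CARD('n)"
  using assms(1)
proof cases
  case (leaf x)
  then show ?thesis using assms(4) by simp
next
  case (node B C g)
  have fin: "finite B" "B \<noteq> {}" "finite C" "C \<noteq> {}"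
    using colour_tree_finite node by auto
  have "vec.dim (dirs B) + vec.dim (dirs C) < CARD('n)"
    using alg_col_const(1)[OF node(4) fin(2,4) _ node(5)] assms(2) node(1) by simp
  moreover have "card B \<le> max 1 (2 * vec.dim (dirs B))" "card C \<le> max 1 (2 * vec.dim (dirs C))"
    using card_alg_col_tree_le[OF node(2)] card_alg_col_tree_le[OF node(3)] assms(2,3) node(1) by simp_all
  moreover have "card A = card B + card C"
    using fin node by (simp add: card_Un_disjoint)
  ultimately show ?thesis using assms(4) by linarith
qed

section \<open>Colourings whose sparsely coloured sets are trees\<close>

definition pairs :: "'a::linorder set \<Rightarrow> ('a \<times> 'a) set" where
  "pairs S = {(x, y). x \<in> S \<and> y \<in> S \<and> x < y}"

text \<open>Only increasing pairs are read, so \<open>c\<close> need not be symmetric; neither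
  \<open>block_col\<close> nor \<open>alg_col\<close> is.\<close>

definition colours :: "('a::linorder \<Rightarrow> 'a \<Rightarrow> 'c) \<Rightarrow> 'a set \<Rightarrow> 'c set" where
  "colours c S = (\<lambda>(x, y). c x y) ` pairs S"

lemma finite_pairs [simp]: "finite S \<Longrightarrow> finite (pairs S)"
  by (rule finite_subset[of _ "S \<times> S"]) (auto simp: pairs_def)

lemma finite_colours [simp]: "finite S \<Longrightarrow> finite (colours c S)"
  by (simp add: colours_def)

lemma in_colours_iff: "d \<in> colours c S \<longleftrightarrow> (\<exists>x\<in>S. \<exists>y\<in>S. x < y \<and> d = c x y)"
  by (auto simp: colours_def pairs_def)

lemma coloursI: "x \<in> S \<Longrightarrow> y \<in> S \<Longrightarrow> x < y \<Longrightarrow> c x y \<in> colours c S"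
  by (auto simp: in_colours_iff)

lemma colours_mono: "S \<subseteq> T \<Longrightarrow> colours c S \<subseteq> colours c T"
  by (fastforce simp: in_colours_iff)

lemma colours_singleton [simp]: "colours c {x} = {}"
  by (auto simp: in_colours_iff)

text \<open>The square splits into the increasing pairs, their mirror images and the diagonal. This
  form of the binomial coefficient avoids division and subtraction.\<close>

lemma card_pairs:
  assumes "finite S" shows "2 * card (pairs S) + card S = card S * card S"
proof -
  have "card (S \<times> S) = card (pairs S \<union> (prod.swap ` pairs S \<union> (\<lambda>x. (x, x)) ` S))"
    by (rule arg_cong[of _ _ card]) (auto simp: pairs_def image_iff)
  also have "\<dots> = card (pairs S) + (card (prod.swap ` pairs S) + card ((\<lambda>x. (x, x)) ` S))"
  proof -
    have "card (prod.swap ` pairs S \<union> (\<lambda>x. (x, x)) ` S) = card (prod.swap ` pairs S) + card ((\<lambda>x. (x, x)) ` S)"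
      using assms finite_pairs[OF assms] by (intro card_Un_disjoint finite_imageI) (auto simp: pairs_def)
    moreover have "card (pairs S \<union> (prod.swap ` pairs S \<union> (\<lambda>x. (x, x)) ` S)) =
        card (pairs S) + card (prod.swap ` pairs S \<union> (\<lambda>x. (x, x)) ` S)"
      using assms finite_pairs[OF assms] by (intro card_Un_disjoint finite_UnI finite_imageI) (auto simp: pairs_def)
    ultimately show ?thesis by simp
  qed
  also have "card (prod.swap ` pairs S) = card (pairs S)"
    by (intro card_image) simp
  also have "card ((\<lambda>x. (x, x)) ` S) = card S"
    by (intro card_image) (simp add: inj_on_def)
  finally show ?thesis by (simp add: card_cartesian_product)
qed

lemma card_colours_le: "finite S \<Longrightarrow> card (colours c S) \<le> card (pairs S)"
  unfolding colours_def by (intro card_image_le) simp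

lemma card_le_card_pairs:
  assumes "finite S" "card S \<noteq> 0" shows "card S \<le> card (pairs S) + 1"
proof -
  have "2 * card S \<le> card S * card S - card S + 2"
    using assms(2) by (cases "card S") (auto simp: algebra_simps)
  then show ?thesis using card_pairs[OF assms(1)] by linarith
qed

lemma card_le_card_pairs3:
  assumes "finite S" "card S \<ge> 3" shows "card S \<le> card (pairs S)"
proof -
  have "3 * card S \<le> card S * card S" using assms(2) by simp
  then show ?thesis using card_pairs[OF assms(1)] by linarith
qed

text \<open>Placing \<open>A\<close> entirely below \<open>B\<close> ensures that all crossing pairs
  are read in the same direction, which matters once a second, asymmetric colouring is put on the
  same vertices. Distinct colours make the number of colours the number of inner nodes.\<close>

inductive ordered_tree :: "('a::linorder \<Rightarrow> 'a \<Rightarrow> 'c) \<Rightarrow> 'a set \<Rightarrow> bool" for c where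
  leaf: "ordered_tree c {x}"
| node: "ordered_tree c A \<Longrightarrow> ordered_tree c B \<Longrightarrow> (\<And>a b. a \<in> A \<Longrightarrow> b \<in> B \<Longrightarrow> a < b \<and> c a b = g) \<Longrightarrow>
    colours c A \<inter> colours c B = {} \<Longrightarrow> g \<notin> colours c A \<Longrightarrow> g \<notin> colours c B \<Longrightarrow> ordered_tree c (A \<union> B)"

lemma colours_Un:
  assumes "\<And>a b. a \<in> A \<Longrightarrow> b \<in> B \<Longrightarrow> a < b"
  shows "colours c (A \<union> B) = colours c A \<union> colours c B \<union> (\<lambda>(a, b). c a b) ` (A \<times> B)"
proof -
  have "\<forall>a\<in>A. \<forall>b\<in>B. a < b \<and> \<not> b < a" using assms less_asym by blast
  then have "pairs (A \<union> B) = pairs A \<union> pairs B \<union> A \<times> B" by (auto simp: pairs_def)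
  then show ?thesis by (simp only: colours_def image_Un)
qed

lemma ordered_tree_finite: "ordered_tree c S \<Longrightarrow> finite S \<and> S \<noteq> {}"
  by (induction rule: ordered_tree.induct) auto

lemma ordered_tree_card: "ordered_tree c S \<Longrightarrow> card S = card (colours c S) + 1"
proof (induction rule: ordered_tree.induct)
  case (leaf x)
  then show ?case by simp
next
  case (node A B g)
  have fin: "finite A" "A \<noteq> {}" "finite B" "B \<noteq> {}" using ordered_tree_finite node.hyps by auto
  have "A \<inter> B = {}" using node.hyps(3) by blast
  have "colours c (A \<union> B) = colours c A \<union> colours c B \<union> (\<lambda>(a, b). c a b) ` (A \<times> B)"
    using node.hyps(3) by (intro colours_Un) blast
  also have "(\<lambda>(a, b). c a b) ` (A \<times> B) = {g}"
    using node.hyps(3) fin by (force simp: image_iff)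
  finally have "card (colours c (A \<union> B)) = card (colours c A) + card (colours c B) + 1"
    using node.hyps fin by (simp add: card_Un_disjoint)
  then show ?case using node.IH fin \<open>A \<inter> B = {}\<close> by (simp add: card_Un_disjoint)
qed

text \<open>The invariant of the iteration. By \<open>ordered_tree_card\<close>, a nonempty set of
  at most \<open>k\<close> vertices falls short of its own size by at most one colour, and falls
  short only if it is a tree.\<close>

definition tree_or_many :: "nat \<Rightarrow> nat \<Rightarrow> (nat \<Rightarrow> nat \<Rightarrow> 'c) \<Rightarrow> bool" where
  "tree_or_many k N c \<longleftrightarrow> (\<forall>S\<subseteq>{..<N}. S \<noteq> {} \<longrightarrow> card S \<le> k \<longrightarrow> ordered_tree c S \<or> card S \<le> card (colours c S))"

section \<open>The block construction\<close>

datatype 'd scol = Same | Below 'd | Above 'd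
datatype ('c, 'd) bcol = Inner nat nat | Cross 'c "'d scol"

text \<open>Residues of vertices in different blocks can be equal or come in either order. Recording
  which of these happens turns one pair of residues present in two blocks into three crossing
  colours.\<close>

definition signed :: "(nat \<Rightarrow> nat \<Rightarrow> 'd) \<Rightarrow> nat \<Rightarrow> nat \<Rightarrow> 'd scol" where
  "signed \<kappa> u v = (if u = v then Same else if u < v then Below (\<kappa> u v) else Above (\<kappa> v u))"

text \<open>A vertex is a block \<open>x div s\<close> with a residue \<open>x mod s\<close>.
  \<open>Inner\<close> keeps both residues but forgets the block, so it costs at most
  \<open>s * s\<close> colours however many blocks there are; the price is that colours can repeat
  in different blocks.\<close>

definition block_col :: "nat \<Rightarrow> (nat \<Rightarrow> nat \<Rightarrow> 'c) \<Rightarrow> (nat \<Rightarrow> nat \<Rightarrow> 'd) \<Rightarrow> nat \<Rightarrow> nat \<Rightarrow> ('c, 'd) bcol" where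
  "block_col s C \<kappa> x y =
    (if x div s = y div s then Inner (x mod s) (y mod s)
     else Cross (C (x div s) (y div s)) (signed \<kappa> (x mod s) (y mod s)))"

lemma less_if_div_less: "x div s < y div s \<Longrightarrow> x < (y::nat)"
  by (metis div_le_mono leD leI)

text \<open>A pair of residues occurring inside both parts forces, through its two orientations and the
  diagonal, at least three colours between the parts; this outweighs the lost colours as long as
  there are at most eight vertices.\<close>

lemma block_col_tree_case:
  fixes C :: "nat \<Rightarrow> nat \<Rightarrow> 'c" and \<kappa> :: "nat \<Rightarrow> nat \<Rightarrow> 'd" and s :: nat
  defines "p \<equiv> block_col s C \<kappa>"
  assumes SA: "finite SA" "SA \<noteq> {}" "ordered_tree p SA \<or> card SA \<le> card (colours p SA)"
    and SB: "finite SB" "SB \<noteq> {}" "ordered_tree p SB \<or> card SB \<le> card (colours p SB)"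
    and card8: "card SA + card SB \<le> 8"
    and weak: "\<And>V. finite V \<Longrightarrow> V \<subseteq> (\<lambda>x. x mod s) ` SA \<Longrightarrow> 2 * card V \<le> card SA + card SB \<Longrightarrow>
        card V \<le> card (colours \<kappa> V) + 1"
    and AB: "\<And>a b. a \<in> SA \<Longrightarrow> b \<in> SB \<Longrightarrow> a div s < b div s \<and> C (a div s) (b div s) = g"
    and disj: "colours C ((\<lambda>x. x div s) ` SA) \<inter> colours C ((\<lambda>x. x div s) ` SB) = {}"
    and gA: "g \<notin> colours C ((\<lambda>x. x div s) ` SA)" and gB: "g \<notin> colours C ((\<lambda>x. x div s) ` SB)"
  shows "ordered_tree p (SA \<union> SB) \<or> card (SA \<union> SB) \<le> card (colours p (SA \<union> SB))"
proof -
  define D where "D = (\<lambda>(a, b). signed \<kappa> (a mod s) (b mod s)) ` (SA \<times> SB)"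
  define W where "W = (\<lambda>(a, b). p a b) ` (SA \<times> SB)"
  define Q where "Q = colours p SA \<inter> colours p SB"
  have lt: "a < b" if "a \<in> SA" "b \<in> SB" for a b
    using AB[OF that] less_if_div_less by blast
  have colsS: "colours p (SA \<union> SB) = colours p SA \<union> colours p SB \<union> W"
    unfolding W_def using lt by (rule colours_Un)
  have pX: "p a b = Cross g (signed \<kappa> (a mod s) (b mod s))" if "a \<in> SA" "b \<in> SB" for a b
    using AB[OF that] by (simp add: p_def block_col_def)
  have XD: "W = Cross g ` D"
    unfolding W_def D_def image_image using pX by (intro image_cong) auto
  have finX: "finite W" "finite D" using SA SB by (simp_all add: W_def D_def)
  have cardX: "card W = card D" unfolding XD by (intro card_image) (simp add: inj_on_def)
  have Crs: "h \<in> colours C ((\<lambda>x. x div s) ` T)" if hd: "Cross h d \<in> colours p T" for h d T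
  proof -
    obtain x y where xy: "x \<in> T" "y \<in> T" "x < y" "Cross h d = p x y"
      using hd unfolding in_colours_iff by blast
    then have "x div s < y div s" "h = C (x div s) (y div s)"
      using div_le_mono[of x y s] by (auto simp: p_def block_col_def split: if_splits)
    then show ?thesis using xy by (auto intro!: coloursI)
  qed
  have XA: "W \<inter> colours p SA = {}" and XB: "W \<inter> colours p SB = {}"
    using Crs[of g] gA gB by (auto simp: XD)
  have "card (colours p (SA \<union> SB)) = card (colours p SA \<union> colours p SB) + card W"
    unfolding colsS using SA(1) SB(1) finX XA XB by (intro card_Un_disjoint) auto
  moreover have "card (colours p SA) + card (colours p SB) = card (colours p SA \<union> colours p SB) + card Q"
    unfolding Q_def using SA(1) SB(1) by (intro card_Un_Int) auto
  ultimately have N: "card (colours p (SA \<union> SB)) + card Q = card (colours p SA) + card (colours p SB) + card W"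
    by linarith
  \<comment> \<open>A second lower bound that gives up all colours of \<open>SA\<close>; it wins
    over \<open>N\<close> when many colours are shared.\<close>
  have NB: "card (colours p SB) + card W \<le> card (colours p (SA \<union> SB))"
  proof -
    have "card (colours p SB \<union> W) = card (colours p SB) + card W"
      using SB(1) finX XB by (intro card_Un_disjoint) auto
    then show ?thesis
      using card_mono[of "colours p (SA \<union> SB)" "colours p SB \<union> W"] SA(1) SB(1) by (auto simp: colsS finX)
  qed
  have cardS: "card (SA \<union> SB) = card SA + card SB"
    using lt SA SB by (intro card_Un_disjoint) (auto dest: less_imp_neq)
  have leA: "card SA \<le> card (colours p SA) + 1" and leB: "card SB \<le> card (colours p SB) + 1"
    using SA(3) SB(3) ordered_tree_card by fastforce+
  have "W \<noteq> {}" using SA SB by (auto simp: W_def)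
  then have "card W \<noteq> 0" using finX by simp
  show ?thesis
  proof (cases "Q = {}")
    case True
    show ?thesis
    proof (cases "ordered_tree p SA \<and> ordered_tree p SB \<and> card W = 1")
      case True
      then obtain h where "W = {h}" by (auto simp: card_1_singleton_iff)
      then have "p a b = h" if "a \<in> SA" "b \<in> SB" for a b
        using that by (auto simp: W_def)
      then have "ordered_tree p (SA \<union> SB)"
        using True lt XA XB \<open>Q = {}\<close> \<open>W = {h}\<close> by (intro ordered_tree.node[where g = h]) (auto simp: Q_def)
      then show ?thesis ..
    next
      case False
      \<comment> \<open>Either a part that is not a tree lacks no colour, or both are trees and
        \<open>W\<close> has at least two colours.\<close>
      then have "card SA + card SB \<le> card (colours p SA) + card (colours p SB) + card W"
        using SA(3) SB(3) leA leB \<open>card W \<noteq> 0\<close> ordered_tree_card[of p SA] ordered_tree_card[of p SB] by linarith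
      then show ?thesis using N True cardS by simp
    qed
  next
    case False
    \<comment> \<open>The two parts share no colour of \<open>C\<close>, so all shared colours are
      \<open>Inner\<close>; \<open>V\<close> collects their residues.\<close>
    define P where "P = {(u, v). Inner u v \<in> Q}"
    define V where "V = fst ` P \<union> snd ` P"
    have Qin: "\<exists>u v. z = Inner u v" if "z \<in> Q" for z
      using that disj Crs by (cases z) (auto simp: Q_def)
    have QP: "Q = (\<lambda>(u, v). Inner u v) ` P"
      using Qin by (force simp: P_def image_iff)
    have Inc: "u \<in> (\<lambda>x. x mod s) ` T \<and> v \<in> (\<lambda>x. x mod s) ` T \<and> u < v" if uv: "Inner u v \<in> colours p T" for u v T
    proof -
      obtain x y where xy: "x \<in> T" "y \<in> T" "x < y" "Inner u v = p x y"
        using uv unfolding in_colours_iff by blast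
      then have "x div s = y div s" "u = x mod s" "v = y mod s"
        by (auto simp: p_def block_col_def split: if_splits)
      moreover have "x mod s < y mod s"
        using xy(3) \<open>x div s = y div s\<close> by (metis div_mult_mod_eq nat_add_left_cancel_less)
      ultimately show ?thesis using xy by auto
    qed
    have VA: "V \<subseteq> (\<lambda>x. x mod s) ` SA" and VB: "V \<subseteq> (\<lambda>x. x mod s) ` SB"
      using Inc by (auto simp: V_def P_def Q_def)
    have finV: "finite V" using VA SA(1) finite_surj by blast
    have PV: "P \<subseteq> pairs V"
      using Inc by (force simp: V_def P_def Q_def pairs_def)
    then have "card P \<le> card (pairs V)" using finV by (intro card_mono) auto
    moreover have "card Q \<le> card P"
      unfolding QP using finV PV finite_subset by (intro card_image_le) (auto intro: finite_subset)
    ultimately have cQ: "card Q \<le> card (pairs V)" by linarith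
    have vA: "card V \<le> card SA" and vB: "card V \<le> card SB"
      using surj_card_le[OF SA(1) VA] surj_card_le[OF SB(1) VB] .
    have wk: "card V \<le> card (colours \<kappa> V) + 1"
      using weak[OF finV VA] vA vB by linarith
    have "insert Same (Below ` colours \<kappa> V \<union> Above ` colours \<kappa> V) \<subseteq> D"
    proof -
      \<comment> \<open>Every residue in \<open>V\<close> occurs in both parts, so every ordered
        pair from \<open>V\<close>, the diagonal included, occurs across them.\<close>
      have mem: "signed \<kappa> u v \<in> D" if "u \<in> V" "v \<in> V" for u v
        using VA VB that by (auto simp: D_def image_iff) blast
      obtain u where "u \<in> V" using False by (auto simp: V_def QP)
      then have "Same \<in> D" using mem[of u u] by (simp add: signed_def)
      moreover have "Below (\<kappa> u v) \<in> D" "Above (\<kappa> u v) \<in> D" if "u \<in> V" "v \<in> V" "u < v" for u v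
        using mem[of u v] mem[of v u] that by (auto simp: signed_def)
      ultimately show ?thesis by (auto simp: in_colours_iff)
    qed
    then have "card (insert Same (Below ` colours \<kappa> V \<union> Above ` colours \<kappa> V)) \<le> card D"
      using finX by (intro card_mono) auto
    moreover have "card (insert Same (Below ` colours \<kappa> V \<union> Above ` colours \<kappa> V)) = 1 + 2 * card (colours \<kappa> V)"
    proof -
      have "card (Below ` colours \<kappa> V \<union> Above ` colours \<kappa> V) = card (Below ` colours \<kappa> V) + card (Above ` colours \<kappa> V)"
        using finV by (intro card_Un_disjoint) auto
      also have "\<dots> = card (colours \<kappa> V) + card (colours \<kappa> V)"
        by (simp add: card_image inj_on_def)
      finally show ?thesis using finV by (subst card_insert_disjoint) auto
    qed
    ultimately have W: "2 * card V \<le> card W + 1" using wk cardX by linarith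
    have "card V \<noteq> 0" "card V \<noteq> 1"
    proof -
      obtain u v where "(u, v) \<in> P" using False by (auto simp: QP)
      then have "u \<in> V" "v \<in> V" "u < v" using PV by (auto simp: pairs_def)
      then show "card V \<noteq> 0" "card V \<noteq> 1" using finV by (auto simp: card_1_singleton_iff)
    qed
    moreover have "card V \<le> 4" using vA vB card8 by linarith
    ultimately have "card V = 2 \<or> card V = 3 \<or> card V = 4" by linarith
    then have "card SA + card SB \<le> card (colours p (SA \<union> SB))"
    proof (elim disjE)
      \<comment> \<open>Six colours may be shared and seven cross, so \<open>N\<close> could be one
        short. Both parts have exactly four vertices here, and \<open>NB\<close> suffices.\<close>
      assume "card V = 4"
      then show ?thesis using NB W leB vB card8 by linarith
    next
      \<comment> \<open>At least five colours cross and at most three are shared. With two residues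
        the numbers are three and one. The surplus of two is the most that the parts can lack
        together.\<close>
      assume v: "card V = 3"
      then have "card Q \<le> 3" using cQ card_pairs[OF finV] by simp
      then show ?thesis using v N W leA leB by linarith
    next
      assume v: "card V = 2"
      then have "card Q \<le> 1" using cQ card_pairs[OF finV] by simp
      then show ?thesis using v N W leA leB by linarith
    qed
    then show ?thesis using cardS by simp
  qed
qed

text \<open>There are at least \<open>m\<close> crossing colours, as they project onto the colours
  of \<open>C\<close> on the \<open>m\<close> blocks. If no pair of residues repeats in two blocks,
  each block lacks at most one inner colour and the crossing colours make this up. A repeated pair
  gives two extra crossing colours, and with at most eight vertices only one configuration has to be
  ruled out separately.\<close>

lemma block_col_nontree_case:
  fixes C :: "nat \<Rightarrow> nat \<Rightarrow> 'c" and \<kappa> :: "nat \<Rightarrow> nat \<Rightarrow> 'd" and s :: nat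
  defines "p \<equiv> block_col s C \<kappa>"
  assumes fin: "finite S" and "S \<noteq> {}" and card8: "card S \<le> 8"
    and many: "card ((\<lambda>x. x div s) ` S) \<le> card (colours C ((\<lambda>x. x div s) ` S))"
  shows "card S \<le> card (colours p S)"
proof -
  define S' where "S' = (\<lambda>x. x div s) ` S"
  define m where "m = card S'"
  define F where "F v = (\<lambda>x. x mod s) ` {x \<in> S. x div s = v}" for v
  define E where "E = {(u, v). Inner u v \<in> colours p S}"
  define W where "W = {z \<in> colours p S. \<exists>h d. z = Cross h d}"
  \<comment> \<open>The value on \<open>Inner\<close> is unspecified; the map is used on
    \<open>W\<close> only.\<close>
  define \<pi> where "\<pi> z = (case z of Cross h d \<Rightarrow> h)" for z :: "('c, 'd) bcol"
  have many: "m \<le> card (colours C S')" using many by (simp add: m_def S'_def)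
  have finS': "finite S'" using fin by (simp add: S'_def)
  have finF: "finite (F v)" for v using fin by (simp add: F_def)
  have finX: "finite W" using fin by (simp add: W_def)
  have finE: "finite E"
    by (rule finite_subset[of _ "(\<lambda>z. case z of Inner u v \<Rightarrow> (u, v)) ` colours p S"])
      (use fin in \<open>force simp: E_def image_iff\<close>)+
  have cardN: "card (colours p S) = card E + card W"
  proof -
    have "colours p S = (\<lambda>(u, v). Inner u v) ` E \<union> W"
    proof (intro equalityI subsetI)
      fix z assume "z \<in> colours p S"
      then show "z \<in> (\<lambda>(u, v). Inner u v) ` E \<union> W"
        by (cases z) (auto simp: E_def W_def image_iff)
    qed (auto simp: E_def W_def)
    also have "card \<dots> = card ((\<lambda>(u, v). Inner u v :: ('c, 'd) bcol) ` E) + card W"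
      using finE finX by (intro card_Un_disjoint) (auto simp: W_def)
    also have "card ((\<lambda>(u, v). Inner u v :: ('c, 'd) bcol) ` E) = card E"
      by (intro card_image) (auto simp: inj_on_def)
    finally show ?thesis .
  qed
  have cross: "Cross (C v w) (signed \<kappa> f g) \<in> W" if fg: "f \<in> F v" "g \<in> F w" and vw: "v < w" for v w f g
  proof -
    obtain x y where "x \<in> S" "x div s = v" "f = x mod s" "y \<in> S" "y div s = w" "g = y mod s"
      using fg by (auto simp: F_def)
    moreover from this have "x < y" using vw less_if_div_less by blast
    ultimately have "p x y \<in> colours p S" and "p x y = Cross (C v w) (signed \<kappa> f g)"
      using vw by (simp_all only: coloursI) (simp add: p_def block_col_def)
    then show ?thesis by (auto simp: W_def)
  qed
  have neF: "F v \<noteq> {}" if "v \<in> S'" for v using that by (auto simp: F_def S'_def)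
  have img: "\<pi> ` W = colours C S'"
  proof (intro equalityI subsetI)
    fix h assume "h \<in> \<pi> ` W"
    then obtain d where "Cross h d \<in> colours p S" by (auto simp: W_def \<pi>_def)
    then obtain x y where xy: "x \<in> S" "y \<in> S" "x < y" "Cross h d = p x y"
      unfolding in_colours_iff by blast
    then have "x div s < y div s" "h = C (x div s) (y div s)"
      using div_le_mono[of x y s] by (auto simp: p_def block_col_def split: if_splits)
    then show "h \<in> colours C S'" using xy by (auto simp: S'_def intro!: coloursI)
  next
    fix h assume "h \<in> colours C S'"
    then obtain v w where vw: "v \<in> S'" "w \<in> S'" "v < w" "h = C v w"
      unfolding in_colours_iff by blast
    obtain f g where "f \<in> F v" "g \<in> F w" using neF vw by blast
    then have "Cross h (signed \<kappa> f g) \<in> W" using cross vw by blast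
    then show "h \<in> \<pi> ` W" by (force simp: \<pi>_def)
  qed
  have leX: "card (colours C S') \<le> card W" using card_image_le[OF finX, of \<pi>] img by simp
  have EF: "pairs (F v) \<subseteq> E" for v
  proof
    fix z assume "z \<in> pairs (F v)"
    then obtain x y where xy: "x \<in> S" "y \<in> S" "x div s = v" "y div s = v" "x mod s < y mod s"
      "z = (x mod s, y mod s)"
      by (auto simp: pairs_def F_def)
    then have "x < y" by (metis div_mult_mod_eq nat_add_left_cancel_less)
    then have "p x y \<in> colours p S" using xy by (intro coloursI)
    then show "z \<in> E" using xy by (simp add: E_def p_def block_col_def)
  qed
  have FE: "E \<subseteq> (\<Union>v\<in>S'. pairs (F v))"
  proof
    fix z assume "z \<in> E"
    then obtain u v where "z = (u, v)" "Inner u v \<in> colours p S" by (auto simp: E_def)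
    then obtain x y where xy: "x \<in> S" "y \<in> S" "x < y" "Inner u v = p x y"
      unfolding in_colours_iff by blast
    then have "x div s = y div s" "u = x mod s" "v = y mod s"
      by (auto simp: p_def block_col_def split: if_splits)
    moreover have "x mod s < y mod s"
      using xy(3) \<open>x div s = y div s\<close> by (metis div_mult_mod_eq nat_add_left_cancel_less)
    ultimately have "z \<in> pairs (F (x div s))"
      using xy \<open>z = (u, v)\<close> by (auto simp: pairs_def F_def)
    then show "z \<in> (\<Union>v\<in>S'. pairs (F v))" using xy by (auto simp: S'_def)
  qed
  have cardF: "card (F v) = card {x \<in> S. x div s = v}" for v
    unfolding F_def by (intro card_image) (auto simp: inj_on_def, metis div_mult_mod_eq)
  have cardS: "card S = (\<Sum>v\<in>S'. card (F v))"
    unfolding cardF S'_def using card_eq_sum sum.image_gen[OF fin, of "\<lambda>_. 1::nat" "\<lambda>x. x div s"] by simp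
  have F1: "card (F v) \<le> card (pairs (F v)) + 1" if "v \<in> S'" for v
    using neF[OF that] finF by (intro card_le_card_pairs) simp_all
  show ?thesis
  proof (cases "\<forall>v\<in>S'. \<forall>w\<in>S'. v \<noteq> w \<longrightarrow> pairs (F v) \<inter> pairs (F w) = {}")
    case True
    have "card S \<le> (\<Sum>v\<in>S'. card (pairs (F v)) + 1)"
      unfolding cardS by (rule sum_mono) (rule F1)
    also have "\<dots> = (\<Sum>v\<in>S'. card (pairs (F v))) + m"
      by (simp only: sum.distrib m_def card_eq_sum)
    also have "(\<Sum>v\<in>S'. card (pairs (F v))) = card (\<Union>v\<in>S'. pairs (F v))"
      using True finS' finF by (subst card_UN_disjoint) auto
    also have "\<dots> \<le> card E" using EF finE by (intro card_mono) auto
    finally show ?thesis using cardN leX many by linarith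
  next
    case False
    then obtain v w f g where vw: "v \<in> S'" "w \<in> S'" "v < w" and fg: "(f, g) \<in> pairs (F v)" "(f, g) \<in> pairs (F w)"
      by (metis disjoint_iff linorder_neqE_nat prod.exhaust)
    have three: "{Cross (C v w) Same, Cross (C v w) (Below (\<kappa> f g)), Cross (C v w) (Above (\<kappa> f g))} \<subseteq> W"
      if "(f, g) \<in> pairs (F v)" "(f, g) \<in> pairs (F w)" "v < w" for v w f g
      using cross[of f v f w] cross[of f v g w] cross[of g v f w] that by (auto simp: pairs_def signed_def)
    define T where "T = {z \<in> W. \<pi> z = C v w}"
    have T3: "3 \<le> card T"
    proof -
      have "{Cross (C v w) Same, Cross (C v w) (Below (\<kappa> f g)), Cross (C v w) (Above (\<kappa> f g))} \<subseteq> T"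
        using three[OF fg vw(3)] by (auto simp: T_def \<pi>_def)
      then have "card {Cross (C v w) Same, Cross (C v w) (Below (\<kappa> f g)), Cross (C v w) (Above (\<kappa> f g))} \<le> card T"
        using finX by (intro card_mono) (auto simp: T_def)
      then show ?thesis by simp
    qed
    \<comment> \<open>All of \<open>T\<close> projects to a single colour, so removing its three or
      more elements loses at most one colour of \<open>C\<close>.\<close>
    have "colours C S' \<subseteq> insert (C v w) (\<pi> ` (W - T))"
      using img by (auto simp: T_def)
    then have "card (colours C S') \<le> card (insert (C v w) (\<pi> ` (W - T)))"
      using finX by (intro card_mono) auto
    also have "\<dots> \<le> card (\<pi> ` (W - T)) + 1" using finX by (simp add: card_insert_if)
    also have "card (\<pi> ` (W - T)) \<le> card (W - T)" using finX by (intro card_image_le) auto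
    also have "card (W - T) = card W - card T" using finX by (intro card_Diff_subset) (auto simp: T_def)
    finally have X2: "m + 2 \<le> card W"
      using T3 many card_mono[OF finX, of T] by (auto simp: T_def)
    have "m \<noteq> 0" using \<open>v \<in> S'\<close> finS' by (auto simp: m_def)
    \<comment> \<open>At least \<open>m\<close> colours need at least \<open>m\<close> pairs of
      blocks, hence three blocks.\<close>
    have "2 * card (pairs S') + m = m * m" using card_pairs[OF finS'] by (simp only: m_def)
    then have "3 * m \<le> m * m" using many card_colours_le[OF finS', of C] by linarith
    then have m3: "3 \<le> m" using \<open>m \<noteq> 0\<close> by simp
    have E1: "1 \<le> card E"
      using EF fg(1) finE by (metis card_0_eq empty_iff less_one not_le subsetD)
    show ?thesis
    proof (rule ccontr)
      assume "\<not> ?thesis"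
      then have bad: "card E + card W < card S" using cardN by simp
      have F2: "card (F v) \<le> 2" if "v \<in> S'" for v
      proof (rule ccontr)
        assume "\<not> ?thesis"
        then have "3 \<le> card (pairs (F v))" using card_le_card_pairs3[OF finF, of v] by linarith
        also have "\<dots> \<le> card E" using EF finE by (intro card_mono)
        finally show False using bad X2 m3 card8 by linarith
      qed
      have "card S \<le> (\<Sum>v\<in>S'. 2)" unfolding cardS by (rule sum_mono) (rule F2)
      then have "card S \<le> 2 * m" by (simp add: m_def)
      \<comment> \<open>From \<open>m + 3 \<le> card E + card W < card S\<close> and
        \<open>card S \<le> 2 * m\<close> it follows that \<open>m \<ge> 4\<close>, and
        \<open>card S \<le> 8\<close> leaves no other choice.\<close>
      then have eqs: "m = 4" "card S = 8" "card E = 1" using bad X2 E1 m3 card8 by linarith+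
      then obtain e where e: "E = {e}" by (auto simp: card_1_singleton_iff)
      then have e: "E = {(f, g)}" using EF fg(1) by blast
      have F2': "card (F u) = 2" if "u \<in> S'" for u
      proof (rule ccontr)
        assume "card (F u) \<noteq> 2"
        then have "card (F u) < 2" using F2[OF that] by linarith
        then have "(\<Sum>v\<in>S'. card (F v)) < (\<Sum>v\<in>S'. 2)"
          using F2 that finS' by (intro sum_strict_mono_ex1) auto
        then show False using eqs cardS by (simp add: m_def)
      qed
      have Ffg: "(f, g) \<in> pairs (F u)" if "u \<in> S'" for u
      proof -
        have "card (pairs (F u)) \<noteq> 0" using F1[OF that] F2'[OF that] by linarith
        then have "pairs (F u) \<noteq> {}" by auto
        then show ?thesis using EF[of u] e by auto
      qed
      \<comment> \<open>All four blocks have the same two residues, so each of the at least four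
        colours of \<open>C\<close> comes with all three signs: twelve crossing colours against
        fewer than eight.\<close>
      define K where "K = {Same, Below (\<kappa> f g), Above (\<kappa> f g)}"
      have "(\<lambda>(h, d). Cross h d) ` (colours C S' \<times> K) \<subseteq> W"
      proof clarify
        fix h d assume "h \<in> colours C S'" "d \<in> K"
        moreover then obtain v w where "v \<in> S'" "w \<in> S'" "v < w" "h = C v w"
          unfolding in_colours_iff by blast
        ultimately show "Cross h d \<in> W" using three[OF Ffg Ffg, of v w] by (auto simp: K_def)
      qed
      then have "card ((\<lambda>(h, d). Cross h d) ` (colours C S' \<times> K)) \<le> card W"
        using finX by (intro card_mono)
      moreover have "card ((\<lambda>(h, d). Cross h d) ` (colours C S' \<times> K)) = card (colours C S') * 3"
        by (subst card_image) (auto simp: inj_on_def card_cartesian_product K_def)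
      ultimately show False using bad eqs many by linarith
    qed
  qed
qed

text \<open>Induction on the size of \<open>S\<close>, following the tree of its blocks. Inside one
  block all pairs have different colours; a root split of the blocks splits \<open>S\<close> into
  smaller sets. The condition on \<kappa> concerns sets of at most half the size, because the
  residues in question occur in both parts.\<close>

lemma tree_or_many_block_col:
  assumes C: "tree_or_many k M C" and k: "k \<le> 8"
    and weak: "\<And>V. V \<subseteq> {..<s} \<Longrightarrow> 2 * card V \<le> k \<Longrightarrow> card V \<le> card (colours \<kappa> V) + 1"
  shows "tree_or_many k (M * s) (block_col s C \<kappa>)"
  unfolding tree_or_many_def
proof (intro allI impI)
  fix S assume "S \<subseteq> {..<M * s}" "S \<noteq> {}" "card S \<le> k"
  then show "ordered_tree (block_col s C \<kappa>) S \<or> card S \<le> card (colours (block_col s C \<kappa>) S)"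
  proof (induction "card S" arbitrary: S rule: less_induct)
    case less
    let ?p = "block_col s C \<kappa>"
    define S' where "S' = (\<lambda>x. x div s) ` S"
    have fin: "finite S" using less.prems(1) finite_subset by blast
    have "s \<noteq> 0" using less.prems(1,2) by auto
    have "S' \<subseteq> {..<M}"
      using less.prems(1) by (auto simp: S'_def less_mult_imp_div_less)
    moreover have "card S' \<le> k"
      using card_image_le[OF fin, of "\<lambda>x. x div s"] less.prems(3) by (simp add: S'_def)
    moreover have "S' \<noteq> {}" using less.prems(2) by (simp add: S'_def)
    ultimately have "ordered_tree C S' \<or> card S' \<le> card (colours C S')"
      using C by (simp add: tree_or_many_def)
    then show ?case
    proof
      assume "card S' \<le> card (colours C S')"
      then show ?thesis
        using block_col_nontree_case[OF fin less.prems(2), of s C \<kappa>] less.prems(3) k by (simp add: S'_def)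
    next
      assume "ordered_tree C S'"
      then show ?thesis
      proof cases
        case (leaf v)
        then have div: "x div s = v" if "x \<in> S" for x using that by (auto simp: S'_def)
        have col: "?p x y = Inner (x mod s) (y mod s)" if "x \<in> S" "y \<in> S" for x y
          using div that by (simp add: block_col_def)
        have "card S \<noteq> 0" using fin less.prems(2) by simp
        then consider "card S = 1" | "card S = 2" | "card S \<ge> 3" by linarith
        then show ?thesis
        proof cases
          case 1
          then show ?thesis by (auto simp: card_1_singleton_iff intro: ordered_tree.leaf)
        next
          case 2
          then obtain x y where xy: "S = {x, y}" "x < y"
            by (metis card_2_iff insert_commute linorder_neqE_nat)
          have "ordered_tree ?p ({x} \<union> {y})"
            using xy by (intro ordered_tree.node[where g = "?p x y"] ordered_tree.leaf) auto
          then show ?thesis using xy by (simp add: insert_is_Un[of x "{y}"])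
        next
          case 3
          have "inj_on (\<lambda>(x, y). ?p x y) (pairs S)"
          proof (rule inj_onI, clarify)
            fix x y x' y' assume a: "(x, y) \<in> pairs S" "(x', y') \<in> pairs S" "?p x y = ?p x' y'"
            then have "x \<in> S" "y \<in> S" "x' \<in> S" "y' \<in> S" by (auto simp: pairs_def)
            then have "x mod s = x' mod s" "y mod s = y' mod s" "x div s = x' div s" "y div s = y' div s"
              using a(3) col div by auto
            then show "x = x' \<and> y = y'" by (metis div_mult_mod_eq)
          qed
          then have "card (colours ?p S) = card (pairs S)"
            unfolding colours_def by (rule card_image)
          then show ?thesis using card_le_card_pairs3[OF fin 3] by simp
        qed
      next
        case (node A B g)
        define SA where "SA = {x \<in> S. x div s \<in> A}"
        define SB where "SB = {x \<in> S. x div s \<in> B}"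
        have AB: "a < b \<and> C a b = g" if "a \<in> A" "b \<in> B" for a b using node(4) that by blast
        have S: "S = SA \<union> SB"
          using node(1) by (auto simp: SA_def SB_def S'_def)
        have disj: "SA \<inter> SB = {}" using AB by (fastforce simp: SA_def SB_def)
        have A: "(\<lambda>x. x div s) ` SA = A" and B: "(\<lambda>x. x div s) ` SB = B"
          using node(1) by (auto simp: SA_def SB_def S'_def)
        have ne: "SA \<noteq> {}" "SB \<noteq> {}" using A B ordered_tree_finite node(2,3) by blast+
        have finAB: "finite SA" "finite SB" using fin S by auto
        have cardS: "card S = card SA + card SB"
          unfolding S using finAB disj by (rule card_Un_disjoint)
        have pos: "card SA \<noteq> 0" "card SB \<noteq> 0" using finAB ne by auto
        have sub: "SA \<subseteq> {..<M * s}" "SB \<subseteq> {..<M * s}" using S less.prems(1) by auto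
        have "ordered_tree ?p (SA \<union> SB) \<or> card (SA \<union> SB) \<le> card (colours ?p (SA \<union> SB))"
        proof (rule block_col_tree_case[where g = g])
          show "ordered_tree ?p SA \<or> card SA \<le> card (colours ?p SA)"
            using less.hyps[of SA] sub ne cardS pos less.prems(3) by linarith
          show "ordered_tree ?p SB \<or> card SB \<le> card (colours ?p SB)"
            using less.hyps[of SB] sub ne cardS pos less.prems(3) by linarith
          show "card SA + card SB \<le> 8" using cardS less.prems(3) k by linarith
          show "card V \<le> card (colours \<kappa> V) + 1"
            if "V \<subseteq> (\<lambda>x. x mod s) ` SA" "2 * card V \<le> card SA + card SB" for V
          proof (rule weak)
            show "V \<subseteq> {..<s}" using that(1) \<open>s \<noteq> 0\<close> by auto
            show "2 * card V \<le> k" using that(2) cardS less.prems(3) by linarith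
          qed
          show "a div s < b div s \<and> C (a div s) (b div s) = g" if "a \<in> SA" "b \<in> SB" for a b
            using AB that by (auto simp: SA_def SB_def)
        qed (use finAB ne node in \<open>simp_all add: A B\<close>)
        then show ?thesis using S by simp
      qed
    qed
  qed
qed

section \<open>Iterating the block construction\<close>

lemma colours_comp: "colours (\<lambda>x y. f (c x y)) S = f ` colours c S"
  by (simp add: colours_def image_image case_prod_unfold)

lemma ordered_tree_relabel: "ordered_tree c S \<Longrightarrow> inj_on f (colours c S) \<Longrightarrow> ordered_tree (\<lambda>x y. f (c x y)) S"
proof (induction rule: ordered_tree.induct)
  case (leaf x)
  show ?case by (rule ordered_tree.leaf)
next
  case (node A B g)
  have sub: "colours c A \<subseteq> colours c (A \<union> B)" "colours c B \<subseteq> colours c (A \<union> B)"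
    by (simp_all add: colours_mono)
  have "A \<noteq> {}" "B \<noteq> {}" using ordered_tree_finite[OF node.hyps(1)] ordered_tree_finite[OF node.hyps(2)] by auto
  then obtain a b where "a \<in> A" "b \<in> B" by auto
  then have "g \<in> colours c (A \<union> B)"
    using node.hyps(3)[of a b] coloursI[of a "A \<union> B" b c] by auto
  then have g: "f g \<notin> f ` colours c A" "f g \<notin> f ` colours c B"
    using node.hyps(5,6) node.prems sub by (auto dest!: inj_onD)
  have d: "f ` colours c A \<inter> f ` colours c B = {}"
    using inj_on_image_Int[OF node.prems sub] node.hyps(4) by simp
  show ?case
  proof (rule ordered_tree.node[where g = "f g"])
    show "ordered_tree (\<lambda>x y. f (c x y)) A" "ordered_tree (\<lambda>x y. f (c x y)) B"
      using node.IH node.prems sub by (blast intro: inj_on_subset)+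
  qed (use node.hyps(3) g d in \<open>auto simp: colours_comp\<close>)
qed

lemma tree_or_many_relabel:
  assumes "tree_or_many k N c" "inj_on f (colours c {..<N})"
  shows "tree_or_many k N (\<lambda>x y. f (c x y))"
  unfolding tree_or_many_def
proof (intro allI impI)
  fix S assume S: "S \<subseteq> {..<N}" "S \<noteq> {}" "card S \<le> k"
  have inj: "inj_on f (colours c S)" using assms(2) colours_mono[OF S(1)] by (rule inj_on_subset)
  then have "card (colours (\<lambda>x y. f (c x y)) S) = card (colours c S)"
    unfolding colours_comp by (rule card_image)
  then show "ordered_tree (\<lambda>x y. f (c x y)) S \<or> card S \<le> card (colours (\<lambda>x y. f (c x y)) S)"
    using assms(1) S ordered_tree_relabel[OF _ inj] by (auto simp: tree_or_many_def)
qed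

text \<open>Fixing the colours to be natural numbers lets the nested colour types of repeated block
  constructions be renamed to one type at each step.\<close>

definition has_tree_colouring :: "nat \<Rightarrow> nat \<Rightarrow> nat \<Rightarrow> bool" where
  "has_tree_colouring k N K \<longleftrightarrow> (\<exists>c :: nat \<Rightarrow> nat \<Rightarrow> nat. tree_or_many k N c \<and> card (colours c {..<N}) \<le> K)"

lemma has_tree_colouring_mono: "has_tree_colouring k N K \<Longrightarrow> K \<le> K' \<Longrightarrow> has_tree_colouring k N K'"
  by (auto simp: has_tree_colouring_def)

lemma has_tree_colouringI:
  assumes "tree_or_many k N c" "card (colours c {..<N}) \<le> K"
  shows "has_tree_colouring k N K"
proof -
  obtain f :: "_ \<Rightarrow> nat" where "inj_on f (colours c {..<N})"
    using finite_imp_inj_to_nat_seg[of "colours c {..<N}"] by auto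
  then show ?thesis
    unfolding has_tree_colouring_def
    using tree_or_many_relabel[OF assms(1)] assms(2) by (intro exI[of _ "\<lambda>x y. f (c x y)"]) (simp add: colours_comp card_image)
qed

lemma card_scols_le:
  assumes "finite D"
  shows "card (insert Same (Below ` D \<union> Above ` D)) \<le> 2 * card D + 1"
proof -
  have "card (insert Same (Below ` D \<union> Above ` D)) \<le> card (Below ` D \<union> Above ` D) + 1"
    using assms by (simp add: card_insert_if)
  also have "card (Below ` D \<union> Above ` D) \<le> card (Below ` D) + card (Above ` D)" by (rule card_Un_le)
  also have "\<dots> = card D + card D" by (simp add: card_image inj_on_def)
  finally show ?thesis by simp
qed

text \<open>Pairs of residues account for \<open>s * s\<close>; each of the \<open>K\<close> outer
  colours is combined with \<open>Same\<close> or with one of \<open>L\<close> colours in one of two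
  directions.\<close>

lemma has_tree_colouring_mult:
  assumes "has_tree_colouring k M K" "k \<le> 8"
    and weak: "\<And>V. V \<subseteq> {..<s} \<Longrightarrow> 2 * card V \<le> k \<Longrightarrow> card V \<le> card (colours \<kappa> V) + 1"
    and L: "card (colours \<kappa> {..<s}) \<le> L"
  shows "has_tree_colouring k (M * s) (s * s + K * (2 * L + 1))"
proof -
  obtain C :: "nat \<Rightarrow> nat \<Rightarrow> nat" where C: "tree_or_many k M C" "card (colours C {..<M}) \<le> K"
    using assms(1) by (auto simp: has_tree_colouring_def)
  define Z where "Z = insert Same (Below ` colours \<kappa> {..<s} \<union> Above ` colours \<kappa> {..<s})"
  have "colours (block_col s C \<kappa>) {..<M * s} \<subseteq>
      (\<lambda>(u, v). Inner u v) ` ({..<s} \<times> {..<s}) \<union> (\<lambda>(h, d). Cross h d) ` (colours C {..<M} \<times> Z)"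
  proof
    fix z assume "z \<in> colours (block_col s C \<kappa>) {..<M * s}"
    then obtain x y where xy: "x < M * s" "y < M * s" "x < y" "z = block_col s C \<kappa> x y"
      unfolding in_colours_iff by blast
    then have s: "s \<noteq> 0" by (cases s) auto
    have div: "x div s < M" "y div s < M" using xy by (simp_all add: less_mult_imp_div_less)
    have "signed \<kappa> u v \<in> Z" if "u < s" "v < s" for u v
      using that by (auto simp: Z_def signed_def intro!: imageI coloursI)
    moreover have "C (x div s) (y div s) \<in> colours C {..<M}" if "x div s \<noteq> y div s"
      using div that div_le_mono[of x y s] xy(3) by (intro coloursI) auto
    ultimately show "z \<in> (\<lambda>(u, v). Inner u v) ` ({..<s} \<times> {..<s}) \<union> (\<lambda>(h, d). Cross h d) ` (colours C {..<M} \<times> Z)"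
      using xy(4) s by (auto simp: block_col_def)
  qed
  then have "card (colours (block_col s C \<kappa>) {..<M * s}) \<le>
      card ((\<lambda>(u, v). Inner u v) ` ({..<s} \<times> {..<s}) \<union> (\<lambda>(h, d). Cross h d) ` (colours C {..<M} \<times> Z))"
    by (rule card_mono[rotated]) (simp add: Z_def)
  also have "\<dots> \<le> card ((\<lambda>(u, v). Inner u v :: (nat, 'a) bcol) ` ({..<s} \<times> {..<s})) +
      card ((\<lambda>(h, d). Cross h d) ` (colours C {..<M} \<times> Z))"
    by (rule card_Un_le)
  also have "\<dots> \<le> card ({..<s} \<times> {..<s}) + card (colours C {..<M} \<times> Z)"
    by (intro add_mono card_image_le) (simp_all add: Z_def)
  also have "\<dots> = s * s + card (colours C {..<M}) * card Z"
    by (simp add: card_cartesian_product)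
  also have "\<dots> \<le> s * s + K * (2 * L + 1)"
    using card_scols_le[of "colours \<kappa> {..<s}"] L C(2) by (intro add_mono mult_mono) (auto simp: Z_def)
  finally show ?thesis
    using tree_or_many_block_col[OF C(1) assms(2) weak] has_tree_colouringI by blast
qed

lemma has_tree_colouring_1: "has_tree_colouring k 1 0"
proof -
  have "S = {0}" if "S \<subseteq> {..<1}" "S \<noteq> {}" for S :: "nat set"
    using that by auto
  moreover have "{..<1} = {0::nat}" by auto
  ultimately show ?thesis
    unfolding has_tree_colouring_def tree_or_many_def using ordered_tree.leaf[of "\<lambda>_ _. 0::nat" "0::nat"]
    by (intro exI[of _ "\<lambda>_ _. 0"]) auto
qed

lemma has_tree_colouring_power:
  assumes "k \<le> 8"
    and weak: "\<And>V. V \<subseteq> {..<s} \<Longrightarrow> 2 * card V \<le> k \<Longrightarrow> card V \<le> card (colours \<kappa> V) + 1"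
    and L: "card (colours \<kappa> {..<s}) \<le> L"
  shows "has_tree_colouring k (s ^ a) (a * (s * s) * (2 * L + 1) ^ a)"
proof (induction a)
  case 0
  then show ?case using has_tree_colouring_1 by simp
next
  case (Suc a)
  have "has_tree_colouring k (s ^ a * s) (s * s + a * (s * s) * (2 * L + 1) ^ a * (2 * L + 1))"
    by (rule has_tree_colouring_mult[OF Suc assms(1) weak L])
  moreover have "s * s + a * (s * s) * (2 * L + 1) ^ a * (2 * L + 1) \<le> Suc a * (s * s) * (2 * L + 1) ^ Suc a"
  proof -
    have "s * s * 1 \<le> s * s * (2 * L + 1) ^ Suc a"
      by (intro mult_le_mono2) (simp only: one_le_power le_add2)
    moreover have "Suc a * (s * s) * (2 * L + 1) ^ Suc a =
        s * s * (2 * L + 1) ^ Suc a + a * (s * s) * (2 * L + 1) ^ a * (2 * L + 1)"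
      by (simp only: mult_Suc power_Suc2 distrib_right mult.assoc)
    ultimately show ?thesis by linarith
  qed
  ultimately have "has_tree_colouring k (s ^ a * s) (Suc a * (s * s) * (2 * L + 1) ^ Suc a)"
    by (rule has_tree_colouring_mono)
  then show ?case by (simp only: power_Suc2)
qed

text \<open>Two levels of iteration. For \<open>k = 5\<close> the condition on \<kappa> concerns at
  most two residues, where a constant colouring will do. The result lacks at most one colour on sets
  of up to four vertices, which is the condition for \<open>k = 8\<close>, now with blocks of size
  \<open>s ^ a\<close>. With \<open>s ^ (a * a)\<close> vertices, the factor
  \<open>s ^ (4 * a)\<close> is their number to the power \<open>4 / a\<close>.\<close>

lemma has_tree_colouring_8:
  assumes "s \<ge> 1" "a \<ge> 1"
  shows "has_tree_colouring 8 (s ^ (a * a)) (a * (3 * a * 3 ^ a) ^ a * s ^ (4 * a))"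
proof -
  have "has_tree_colouring 5 (s ^ a) (a * (s * s) * (2 * 1 + 1) ^ a)"
  proof (rule has_tree_colouring_power)
    let ?\<kappa> = "\<lambda>_ _. 0 :: nat"
    show "card V \<le> card (colours ?\<kappa> V) + 1" if "V \<subseteq> {..<s}" "2 * card V \<le> 5" for V
    proof (cases "card V \<le> 1")
      case False
      then have "card V = 2" using that(2) by linarith
      then obtain x y where "x \<in> V" "y \<in> V" "x < y"
        by (metis card_2_iff' linorder_neqE_nat)
      then have "0 \<in> colours ?\<kappa> V" by (auto simp: in_colours_iff)
      moreover have "finite V" using that(1) finite_subset by blast
      ultimately have "card (colours ?\<kappa> V) \<noteq> 0" by auto
      then show ?thesis using \<open>card V = 2\<close> by linarith
    qed simp
    have "colours ?\<kappa> {..<s} \<subseteq> {0}" by (auto simp: in_colours_iff)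
    from card_mono[OF _ this] show "card (colours ?\<kappa> {..<s}) \<le> 1" by simp
  qed simp
  then obtain \<kappa> :: "nat \<Rightarrow> nat \<Rightarrow> nat"
    where \<kappa>: "tree_or_many 5 (s ^ a) \<kappa>" "card (colours \<kappa> {..<s ^ a}) \<le> a * (s * s) * 3 ^ a"
    by (auto simp: has_tree_colouring_def numeral_3_eq_3)
  have "has_tree_colouring 8 ((s ^ a) ^ a) (a * (s ^ a * s ^ a) * (2 * (a * (s * s) * 3 ^ a) + 1) ^ a)"
  proof (rule has_tree_colouring_power[OF _ _ \<kappa>(2)])
    show "card V \<le> card (colours \<kappa> V) + 1" if "V \<subseteq> {..<s ^ a}" "2 * card V \<le> 8" for V
    proof (cases "V = {}")
      case False
      then have "ordered_tree \<kappa> V \<or> card V \<le> card (colours \<kappa> V)"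
        using \<kappa>(1) that by (simp add: tree_or_many_def)
      then show ?thesis using ordered_tree_card[of \<kappa> V] by linarith
    qed simp
  qed simp
  then have *: "has_tree_colouring 8 (s ^ (a * a)) (a * (s ^ a * s ^ a) * (2 * (a * (s * s) * 3 ^ a) + 1) ^ a)"
    by (simp only: power_mult)
  have le: "a * (s ^ a * s ^ a) * (2 * (a * (s * s) * 3 ^ a) + 1) ^ a \<le>
      a * (s ^ a * s ^ a) * (3 * a * 3 ^ a * (s * s)) ^ a"
  proof (intro mult_left_mono power_mono)
    have "1 \<le> a * (s * s) * 3 ^ a" using assms by simp
    then show "2 * (a * (s * s) * 3 ^ a) + 1 \<le> 3 * a * 3 ^ a * (s * s)" by (simp add: algebra_simps)
  qed simp_all
  have eq: "a * (s ^ a * s ^ a) * (3 * a * 3 ^ a * (s * s)) ^ a = a * (3 * a * 3 ^ a) ^ a * s ^ (4 * a)"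
    by (simp add: power_mult_distrib power_mult power4_eq_xxxx algebra_simps)
  show ?thesis using has_tree_colouring_mono[OF * le] unfolding eq .
qed

section \<open>The product colouring\<close>

lemma card_vec_box:
  fixes G :: "'n::finite \<Rightarrow> 'a set"
  shows "card {x :: 'a ^ 'n. \<forall>i. x $ i \<in> G i} = (\<Prod>i\<in>UNIV. card (G i))"
proof -
  have "bij_betw vec_nth {x :: 'a ^ 'n. \<forall>i. x $ i \<in> G i} (PiE UNIV G)"
    by (rule bij_betw_byWitness[of _ vec_lambda]) (auto simp: PiE_UNIV_domain)
  then show ?thesis by (simp add: bij_betw_same_card card_PiE)
qed

text \<open>The finite field is a subset of a fixed type, so that fields of all orders
  \<open>2 ^ k\<close> are available in one type. Linear algebra is done over the whole type;
  \<open>F\<close> restricts the points and thereby the colours that occur.\<close>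

lemma card_alg_cols_le:
  fixes F :: "'a::field set" and i0 :: "'n::finite"
  assumes F: "finite F" "0 \<in> F" "\<And>x y. x \<in> F \<Longrightarrow> y \<in> F \<Longrightarrow> x + y \<in> F \<and> x - y \<in> F \<and> x * y \<in> F"
    and V: "\<And>x i. x \<in> V \<Longrightarrow> x $ i \<in> F"
  shows "\<exists>H. finite H \<and> card H \<le> (3 * CARD('n) + 1) * card F \<and> (\<forall>x\<in>V. \<forall>y\<in>V. alg_col i0 x y \<in> H)"
proof -
  define U where "U = (UNIV :: 'n set) \<times> F"
  define H where "H = Up ` U \<union> Down ` U \<union> Zero ` U \<union> Dot ` F"
  have dot: "dot x y \<in> F" if "x \<in> V" "y \<in> V" for x y
  proof -
    have "(\<Sum>i\<in>I. x $ i * y $ i) \<in> F" for I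
      by (induction I rule: infinite_finite_induct) (use F V that in auto)
    then show ?thesis by (simp add: dot_def)
  qed
  have "sep_col i0 x y \<in> U" if "x \<in> V" "y \<in> V" for x y
    using F V that by (auto simp: sep_col_def Let_def U_def)
  then have "\<forall>x\<in>V. \<forall>y\<in>V. alg_col i0 x y \<in> H"
    using dot by (auto simp: alg_col_def H_def)
  moreover have "finite H" using F(1) by (simp add: H_def U_def)
  moreover have "card H \<le> card U + card U + card U + card F"
  proof -
    have "card H \<le> card (Up ` U :: ('a, 'n) alg_col set) + card (Down ` U :: ('a, 'n) alg_col set) +
        card (Zero ` U :: ('a, 'n) alg_col set) + card (Dot ` F :: ('a, 'n) alg_col set)"
      unfolding H_def by (intro order_trans[OF card_Un_le] add_mono order_refl)
    also have "\<dots> \<le> card U + card U + card U + card F"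
      using F(1) by (intro add_mono card_image_le) (simp_all add: U_def)
    finally show ?thesis .
  qed
  moreover have "card U = CARD('n) * card F" by (simp add: U_def card_cartesian_product)
  ultimately show ?thesis by (intro exI[of _ H]) (simp add: algebra_simps)
qed

text \<open>Injectivity of \<open>fst\<close> says that the first colour determines the second, so a
  split with constant \<open>c\<close> also has constant \<open>h\<close>.\<close>

lemma ordered_tree_imp_colour_tree:
  assumes "ordered_tree c T" "T \<subseteq> S" "inj_on \<psi> S"
    and fst_inj: "inj_on fst (colours (\<lambda>x y. (c x y, h (\<psi> x) (\<psi> y))) S)"
  shows "colour_tree h (\<psi> ` T)"
  using assms(1,2)
proof (induction rule: ordered_tree.induct)
  case (leaf x)
  show ?case using colour_tree.leaf by simp
next
  case (node A B g)
  have "A \<noteq> {}" "B \<noteq> {}" using ordered_tree_finite[OF node.hyps(1)] ordered_tree_finite[OF node.hyps(2)] by auto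
  then obtain a0 b0 where ab0: "a0 \<in> A" "b0 \<in> B" by auto
  let ?g = "\<lambda>x y. (c x y, h (\<psi> x) (\<psi> y))"
  have "colour_tree h (\<psi> ` A \<union> \<psi> ` B)"
  proof (rule colour_tree.node[where g = "h (\<psi> a0) (\<psi> b0)"])
    show "colour_tree h (\<psi> ` A)" "colour_tree h (\<psi> ` B)" using node by auto
    have "A \<inter> B = {}" using node.hyps(3) by blast
    then show "\<psi> ` A \<inter> \<psi> ` B = {}"
      using inj_on_image_Int[OF assms(3), of A B] node.prems by auto
    show "h u w = h (\<psi> a0) (\<psi> b0)" if "u \<in> \<psi> ` A" "w \<in> \<psi> ` B" for u w
    proof -
      obtain a b where ab: "a \<in> A" "u = \<psi> a" "b \<in> B" "w = \<psi> b" using \<open>u \<in> \<psi> ` A\<close> \<open>w \<in> \<psi> ` B\<close> by auto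
      have "(c x y, h (\<psi> x) (\<psi> y)) \<in> colours ?g S" if "x \<in> A" "y \<in> B" for x y
        by (rule coloursI[of x S y ?g]) (use node.hyps(3)[of x y] node.prems that in auto)
      then have "?g a b = ?g a0 b0"
        using node.hyps(3) ab ab0 by (intro inj_onD[OF fst_inj]) simp_all
      then show ?thesis using ab by simp
    qed
  qed
  then show ?case by (simp add: image_Un)
qed

text \<open>A set of \<open>2 * CARD('n)\<close> vertices with too few product colours is an ordered
  tree for the first colouring. The second colouring then cannot refine the first on it, so it is a
  colour tree for \<open>alg_col\<close>, which is too large for
  \<open>card_alg_col_tree_lt\<close>.\<close>

lemma EG_le:
  fixes F :: "'a::field set" and i0 :: "'n::finite"
  assumes F: "finite F" "0 \<in> F" "\<And>x y. x \<in> F \<Longrightarrow> y \<in> F \<Longrightarrow> x + y \<in> F \<and> x - y \<in> F \<and> x * y \<in> F"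
    and d: "2 \<le> CARD('n)" "CARD('n) \<le> 4"
    and n: "n \<le> (card F - 1) * card F ^ (CARD('n) - 1)"
    and N: "has_tree_colouring 8 N K" "n \<le> N"
  shows "EG n (2 * CARD('n)) (2 * CARD('n)) \<le> K * ((3 * CARD('n) + 1) * card F)"
proof -
  \<comment> \<open>Points need a nonzero coordinate \<open>i0\<close>, which costs only a factor
    \<open>card F - 1\<close> in place of \<open>card F\<close>.\<close>
  define G where "G i = (if i = i0 then F - {0} else F)" for i
  define V where "V = {x :: 'a ^ 'n. \<forall>i. x $ i \<in> G i}"
  have "card V = (\<Prod>i\<in>UNIV. card (G i))" unfolding V_def by (rule card_vec_box)
  also have "\<dots> = card (G i0) * (\<Prod>i\<in>UNIV - {i0}. card (G i))"
    by (subst prod.remove[of _ i0]) auto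
  also have "\<dots> = (card F - 1) * card F ^ (CARD('n) - 1)"
    using F by (simp add: G_def)
  finally have "card {..<n} \<le> card V" using n by simp
  moreover have "finite V"
  proof (rule ccontr)
    assume "infinite V"
    then have "card V = 0" by simp
    moreover have "V \<subseteq> vec_lambda ` (PiE UNIV (\<lambda>_. F))"
    proof
      fix x assume "x \<in> V"
      then have "x = vec_lambda (vec_nth x)" "vec_nth x \<in> PiE UNIV (\<lambda>_. F)"
        by (auto simp: V_def G_def PiE_UNIV_domain split: if_splits)
      then show "x \<in> vec_lambda ` (PiE UNIV (\<lambda>_. F))" by blast
    qed
    then have "finite V" using F(1) finite_surj[OF finite_PiE] by (metis finite)
    then show False using \<open>infinite V\<close> by simp
  qed
  ultimately obtain \<psi> where \<psi>: "inj_on \<psi> {..<n}" "\<psi> ` {..<n} \<subseteq> V"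
    by (metis card_le_inj finite_lessThan)
  have VF: "x $ i \<in> F" and Vi0: "x $ i0 \<noteq> 0" if "x \<in> V" for x i
    using that by (auto simp: V_def G_def split: if_splits)
  obtain H where H: "finite H" "card H \<le> (3 * CARD('n) + 1) * card F" "\<forall>x\<in>V. \<forall>y\<in>V. alg_col i0 x y \<in> H"
    using card_alg_cols_le[OF F VF] by blast
  obtain c :: "nat \<Rightarrow> nat \<Rightarrow> nat" where c: "tree_or_many 8 N c" "card (colours c {..<N}) \<le> K"
    using N(1) by (auto simp: has_tree_colouring_def)
  define g where "g x y = (c x y, alg_col i0 (\<psi> x) (\<psi> y))" for x y
  have sub: "colours g {..<n} \<subseteq> colours c {..<N} \<times> H"
  proof
    fix z assume "z \<in> colours g {..<n}"
    then obtain x y where "x < n" "y < n" "x < y" "z = g x y"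
      unfolding in_colours_iff by blast
    moreover from this have "\<psi> x \<in> V" "\<psi> y \<in> V" using \<psi>(2) by auto
    ultimately show "z \<in> colours c {..<N} \<times> H"
      using H(3) N(2) by (auto simp: g_def intro!: coloursI)
  qed
  have "card (colours g {..<n}) \<le> card (colours c {..<N} \<times> H)"
    using sub H(1) by (intro card_mono) auto
  also have "\<dots> \<le> K * ((3 * CARD('n) + 1) * card F)"
    unfolding card_cartesian_product using c(2) H(2) by (rule mult_le_mono)
  finally have cg: "card (colours g {..<n}) \<le> K * ((3 * CARD('n) + 1) * card F)" .
  \<comment> \<open>The colours in use are renumbered as an initial segment, as
    \<open>good_colouring\<close> requires.\<close>
  obtain f where f: "inj_on f (colours g {..<n})" "f ` colours g {..<n} = {i. i < card (colours g {..<n})}"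
    using ex_bij_betw_finite_nat[of "colours g {..<n}"] by (auto simp: bij_betw_def atLeast0LessThan lessThan_def)
  define col where "col e = f (g (Min e) (Max e))" for e
  have img: "col ` {e. e \<subseteq> S \<and> card e = 2} = f ` colours g S" for S :: "nat set"
  proof (intro equalityI subsetI)
    fix z assume "z \<in> col ` {e. e \<subseteq> S \<and> card e = 2}"
    then obtain e where e: "e \<subseteq> S" "card e = 2" "z = col e" by auto
    then obtain x y where "e = {x, y}" "x < y"
      by (metis card_2_iff insert_commute linorder_neqE_nat)
    then show "z \<in> f ` colours g S" using e by (auto simp: col_def intro!: imageI coloursI)
  next
    fix z assume "z \<in> f ` colours g S"
    then obtain w where w: "z = f w" "w \<in> colours g S" by blast
    obtain x y where "x \<in> S" "y \<in> S" "x < y" "z = f (g x y)"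
      using w(2) unfolding w(1) in_colours_iff by blast
    then have "z = col {x, y}" "{x, y} \<in> {e. e \<subseteq> S \<and> card e = 2}" by (auto simp: col_def)
    then show "z \<in> col ` {e. e \<subseteq> S \<and> card e = 2}" by blast
  qed
  have "good_colouring n (2 * CARD('n)) (2 * CARD('n)) (card (colours g {..<n})) col"
    unfolding good_colouring_def
  proof (intro conjI ballI allI impI)
    fix e assume "e \<in> Kedges n"
    then have "col e \<in> col ` {e. e \<subseteq> {..<n} \<and> card e = 2}" by (auto simp: Kedges_def)
    then show "col e < card (colours g {..<n})" unfolding img f(2) by simp
  next
    fix S assume S: "S \<subseteq> {..<n} \<and> card S = 2 * CARD('n)"
    have "2 * CARD('n) \<le> card (colours g S)"
    proof (rule ccontr)
      assume "\<not> ?thesis"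
      then have less: "card (colours g S) < card S" using S by simp
      have fin: "finite S" using S finite_subset by blast
      have "S \<noteq> {}" using S d by auto
      have fst: "fst ` colours g S = colours c S"
        using colours_comp[of fst g S] by (simp add: g_def)
      have le: "card (colours c S) \<le> card (colours g S)"
        using card_image_le[of "colours g S" fst] fin by (simp add: fst)
      have "S \<subseteq> {..<N}" using S N(2) by auto
      moreover have "card S \<le> 8" using S d(2) by linarith
      ultimately have "ordered_tree c S \<or> card S \<le> card (colours c S)"
        using c(1) \<open>S \<noteq> {}\<close> unfolding tree_or_many_def by blast
      then have tree: "ordered_tree c S" using le less by linarith
      \<comment> \<open>The tree has exactly \<open>card S - 1\<close> colours under
        \<open>c\<close>, while \<open>g\<close> has at least as many and fewer than
        \<open>card S\<close>.\<close>
      then have "card (fst ` colours g S) = card (colours g S)"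
        using ordered_tree_card[OF tree] less le unfolding fst by linarith
      then have "inj_on fst (colours g S)" using fin by (intro eq_card_imp_inj_on) auto
      moreover have inj: "inj_on \<psi> S" using \<psi>(1) S by (blast intro: inj_on_subset)
      ultimately have "colour_tree (alg_col i0) (\<psi> ` S)"
        unfolding g_def by (intro ordered_tree_imp_colour_tree[OF tree subset_refl])
      then have "card (\<psi> ` S) < 2 * CARD('n)"
        by (rule card_alg_col_tree_lt[of i0]) (use \<psi>(2) S Vi0 d in auto)
      moreover have "card (\<psi> ` S) = card S" using inj by (rule card_image)
      ultimately show False using S by simp
    qed
    also have "card (colours g S) = card (f ` colours g S)"
      using colours_mono[of S "{..<n}" g] S by (intro card_image[symmetric] inj_on_subset[OF f(1)]) simp
    finally show "2 * CARD('n) \<le> card (col ` {e. e \<subseteq> S \<and> card e = 2})" unfolding img .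
  qed
  then have "EG n (2 * CARD('n)) (2 * CARD('n)) \<le> card (colours g {..<n})"
    unfolding EG_def by (intro Least_le) blast
  then show ?thesis using cg by simp
qed

section \<open>Fields of order a power of two\<close>

lemma char2: "(x :: bit alg_closure) + x = 0"
proof -
  have "to_ac (1 + 1 :: bit) = to_ac 0" by simp
  then have "(1 + 1 :: bit alg_closure) = 0" unfolding to_ac_add to_ac_1 to_ac_0 .
  then show ?thesis by (metis distrib_left mult.right_neutral mult_zero_right)
qed

lemma frobenius: "((x :: bit alg_closure) + y) ^ (2 ^ k) = x ^ (2 ^ k) + y ^ (2 ^ k)"
proof (induction k)
  case (Suc k)
  have "(x + y) ^ (2 ^ Suc k) = (x ^ (2 ^ k) + y ^ (2 ^ k))\<^sup>2"
    using Suc by (simp add: power_mult mult.commute[of 2])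
  also have "\<dots> = (x ^ (2 ^ k))\<^sup>2 + (y ^ (2 ^ k))\<^sup>2 + (x ^ 2 ^ k * y ^ 2 ^ k + x ^ 2 ^ k * y ^ 2 ^ k)"
    by (simp add: power2_eq_square algebra_simps)
  finally show ?case by (simp add: char2 power_mult mult.commute[of 2])
qed simp

text \<open>The fixed points of the \<open>k\<close>-fold Frobenius map; for
  \<open>k \<ge> 1\<close> this is the subfield of order \<open>2 ^ k\<close>.\<close>

definition gf_pow2 :: "nat \<Rightarrow> bit alg_closure set" where
  "gf_pow2 k = {x. x ^ (2 ^ k) = x}"

lemma gf_pow2_closed:
  assumes "x \<in> gf_pow2 k" "y \<in> gf_pow2 k"
  shows "x + y \<in> gf_pow2 k \<and> x - y \<in> gf_pow2 k \<and> x * y \<in> gf_pow2 k"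
proof -
  have "x - y = x + y" using char2[of y] by (metis add_diff_cancel add.assoc add_0_right)
  then show ?thesis using assms by (simp only: gf_pow2_def mem_Collect_eq frobenius power_mult_distrib)
qed

lemma zero_in_gf_pow2: "0 \<in> gf_pow2 k" by (simp add: gf_pow2_def power_0_left)

text \<open>The field elements are the roots of \<open>p\<close>, which splits over the algebraic
  closure. Its derivative is \<open>- 1\<close>, so no root is repeated and there are as many roots
  as the degree.\<close>

lemma card_gf_pow2:
  assumes "k \<ge> 1" shows "finite (gf_pow2 k)" "card (gf_pow2 k) = 2 ^ k"
proof -
  define p :: "bit alg_closure poly" where "p = monom 1 (2 ^ k) - monom 1 1"
  have k: "(2::nat) ^ k > 1" using assms by (intro one_less_power) auto
  have deg: "degree p = 2 ^ k"
  proof -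
    have "degree p = degree (monom 1 (2 ^ k) :: bit alg_closure poly)"
      unfolding p_def diff_conv_add_uminus using k by (intro degree_add_eq_left) (simp add: degree_monom_eq)
    then show ?thesis by (simp add: degree_monom_eq)
  qed
  have roots: "{x. poly p x = 0} = gf_pow2 k" by (simp add: p_def poly_monom gf_pow2_def)
  have p0: "p \<noteq> 0" using deg k by auto
  have "of_nat (2 ^ k) = (0 :: bit alg_closure)"
    using assms char2[of 1] by (cases k) (simp_all add: numeral_2_eq_2)
  then have deriv: "pderiv p = - 1"
    using assms by (simp add: p_def pderiv_diff pderiv_monom monom_0 one_pCons power_0_left)
  show "finite (gf_pow2 k)" using poly_roots_finite[OF p0] roots by simp
  obtain A where A: "size A = degree p" "p = smult (lead_coeff p) (\<Prod>x\<in>#A. [:-x, 1:])"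
    using alg_closed_imp_factorization[OF p0] by blast
  have "poly p x = 0 \<longleftrightarrow> x \<in># A" for x
    using p0 by (subst A(2)) (auto simp: poly_prod_mset prod_mset_zero_iff)
  then have set: "gf_pow2 k = set_mset A" using roots by auto
  have "count A a = 1" if "a \<in># A" for a
  proof (rule ccontr)
    assume "count A a \<noteq> 1"
    then have "count A a \<ge> 2" using that by (metis One_nat_def Suc_leI le_neq_implies_less numeral_2_eq_2 count_greater_eq_one_iff)
    then have "replicate_mset 2 a \<subseteq># A" by (simp add: count_le_replicate_mset_subset_eq)
    then obtain B where "A = replicate_mset 2 a + B" using subset_mset.le_iff_add by metis
    then have "A = {#a, a#} + B" by (simp add: numeral_2_eq_2)
    then have "p = [:-a, 1:] * ([:-a, 1:] * smult (lead_coeff p) (\<Prod>x\<in>#B. [:-x, 1:]))"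
      by (subst A(2)) (simp add: mult.left_commute)
    then obtain q where q: "p = [:-a, 1:] * ([:-a, 1:] * q)" by blast
    have "poly (pderiv p) a = 0"
      unfolding q pderiv_mult poly_add poly_mult by simp
    then show False by (simp add: deriv)
  qed
  then have "size A = card (set_mset A)" by (simp add: size_multiset_overloaded_eq)
  then show "card (gf_pow2 k) = 2 ^ k" using set A(1) deg by simp
qed

section \<open>Asymptotics\<close>

text \<open>The depth \<open>a\<close> depends on \<epsilon> only, so \<open>C a\<close> is a
  constant. For each \<open>n\<close>, \<open>s\<close> and \<open>k\<close> are taken just large
  enough, up to constant factors.\<close>

lemma eventually_le_powr:
  fixes f :: "nat \<Rightarrow> nat" and C :: "nat \<Rightarrow> nat" and d D :: nat
  assumes d: "d \<ge> 1"
    and f: "\<And>a s k n. 1 \<le> a \<Longrightarrow> 1 \<le> s \<Longrightarrow> 1 \<le> k \<Longrightarrow> n \<le> s ^ (a * a) \<Longrightarrow>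
      n \<le> (2 ^ k - 1) * (2 ^ k) ^ (d - 1) \<Longrightarrow> f n \<le> C a * s ^ (4 * a) * (D * 2 ^ k)"
    and \<epsilon>: "(\<epsilon>::real) > 0"
  shows "\<forall>\<^sub>F n in at_top. real (f n) \<le> real n powr (1 / real d + \<epsilon>)"
proof -
  \<comment> \<open>This makes \<open>4 / a \<le> \<epsilon> / 2\<close>; the other half of
    \<epsilon> absorbs the constant \<open>K\<close>.\<close>
  define a where "a = nat \<lceil>8 / \<epsilon>\<rceil> + 1"
  have a: "1 \<le> a" by (simp add: a_def)
  have "8 / \<epsilon> \<le> real a" unfolding a_def by linarith
  then have a\<epsilon>: "4 / real a \<le> \<epsilon> / 2" using \<epsilon> a by (simp add: field_simps)
  \<comment> \<open>The power of two comes from rounding up \<open>s\<close>; the last factor comes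
    from rounding up \<open>k\<close> and from \<open>2 * n\<close> in place of
    \<open>n\<close>.\<close>
  define K where "K = real (C a) * 2 ^ (4 * a) * real D * (2 * 2 powr (1 / real d))"
  have bound: "real (f n) \<le> K * (real n powr (4 / real a) * real n powr (1 / real d))" if n: "n \<ge> 1" for n
  proof -
    define t where "t = real n powr (1 / real (a * a))"
    have t1: "1 \<le> t" using n by (simp add: t_def ge_one_powr_ge_zero)
    define s where "s = nat \<lceil>t\<rceil>"
    have s: "t \<le> real s" "real s \<le> 2 * t" "1 \<le> s" using t1 by (auto simp: s_def le_nat_iff) linarith+
    have "real n = t ^ (a * a)"
      using n a unfolding t_def by (subst powr_realpow[symmetric]) (auto simp: powr_powr)
    also have "\<dots> \<le> real s ^ (a * a)" using t1 s(1) by (intro power_mono) auto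
    finally have ns: "n \<le> s ^ (a * a)" by (metis of_nat_le_iff of_nat_power)
    have "real s ^ (4 * a) \<le> (2 * t) ^ (4 * a)" using s(2) by (intro power_mono) auto
    also have "\<dots> = 2 ^ (4 * a) * t ^ (4 * a)" by (rule power_mult_distrib)
    also have "t ^ (4 * a) = real n powr (4 / real a)"
      using n a unfolding t_def by (subst powr_realpow[symmetric]) (auto simp: powr_powr field_simps)
    finally have s4: "real s ^ (4 * a) \<le> 2 ^ (4 * a) * real n powr (4 / real a)" .
    \<comment> \<open>Chosen so that \<open>(2 powr l) ^ d = 2 * n\<close>; the factor two pays for
      replacing one factor \<open>2 ^ k\<close> by \<open>2 ^ k - 1\<close>.\<close>
    define l where "l = log 2 (2 * real n) / real d"
    have l0: "0 < l" using n d by (simp add: l_def)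
    define k where "k = nat \<lceil>l\<rceil>"
    have k: "l \<le> real k" "real k \<le> l + 1" "1 \<le> k" using l0 by (auto simp: k_def le_nat_iff)
    have l: "2 powr l = (2 * real n) powr (1 / real d)"
      unfolding l_def using n by (simp add: powr_def log_def)
    have "2 * real n = (2 powr l) ^ d"
      using n d unfolding l by (subst powr_realpow[symmetric]) (auto simp: powr_powr)
    also have "\<dots> \<le> (2 powr real k) ^ d" using k(1) by (intro power_mono) auto
    also have "2 powr real k = (2::real) ^ k" by (simp add: powr_realpow)
    finally have "2 * real n \<le> real ((2 ^ k) ^ d)" by simp
    then have "2 * n \<le> (2 ^ k) ^ d" by (metis of_nat_le_iff of_nat_mult of_nat_numeral)
    also have "(2 ^ k) ^ d = (2 ^ k :: nat) * (2 ^ k) ^ (d - 1)"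
      using d by (cases d) simp_all
    also have "\<dots> \<le> 2 * (2 ^ k - 1) * (2 ^ k) ^ (d - 1)"
    proof (rule mult_le_mono1)
      have "(2::nat) ^ 1 \<le> 2 ^ k" using k(3) by (intro power_increasing) simp_all
      then show "(2::nat) ^ k \<le> 2 * (2 ^ k - 1)" by simp
    qed
    finally have nk: "n \<le> (2 ^ k - 1) * (2 ^ k) ^ (d - 1)" by simp
    have "(2::real) ^ k = 2 powr real k" by (simp add: powr_realpow)
    also have "\<dots> \<le> 2 powr (l + 1)" using k(2) by simp
    also have "\<dots> = 2 * (2 powr (1 / real d) * real n powr (1 / real d))"
      by (simp add: powr_add l powr_mult)
    finally have 2: "(2::real) ^ k \<le> 2 * (2 powr (1 / real d) * real n powr (1 / real d))" .
    have "real (f n) \<le> real (C a * s ^ (4 * a) * (D * 2 ^ k))"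
      using f[OF a s(3) k(3) ns nk] by (simp only: of_nat_le_iff)
    also have "\<dots> = real (C a) * real s ^ (4 * a) * (real D * 2 ^ k)" by simp
    also have "\<dots> \<le> real (C a) * (2 ^ (4 * a) * real n powr (4 / real a)) *
        (real D * (2 * (2 powr (1 / real d) * real n powr (1 / real d))))"
      using s4 2 by (intro mult_mono mult_left_mono) simp_all
    finally show ?thesis by (simp add: K_def mult_ac)
  qed
  have "K \<le> real n powr (\<epsilon> / 2)" if "nat \<lceil>max K 1 powr (2 / \<epsilon>)\<rceil> \<le> n" for n
  proof -
    have "K \<le> (max K 1 powr (2 / \<epsilon>)) powr (\<epsilon> / 2)" using \<epsilon> by (simp add: powr_powr)
    also have "\<dots> \<le> real n powr (\<epsilon> / 2)"
      using that \<epsilon> by (intro powr_mono2) (auto simp: nat_le_iff ceiling_le_iff)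
    finally show ?thesis .
  qed
  then have "\<forall>\<^sub>F n in at_top. K \<le> real n powr (\<epsilon> / 2)"
    by (rule eventually_mono[OF eventually_ge_at_top])
  then show ?thesis
    using eventually_ge_at_top[of 1]
  proof eventually_elim
    case (elim n)
    have "real (f n) \<le> K * (real n powr (4 / real a) * real n powr (1 / real d))"
      using bound elim by simp
    also have "\<dots> \<le> real n powr (\<epsilon> / 2) * (real n powr (\<epsilon> / 2) * real n powr (1 / real d))"
      using elim a\<epsilon> by (intro mult_mono powr_mono) simp_all
    also have "\<dots> = real n powr (1 / real d + \<epsilon>)"
      by (simp flip: powr_add add: field_simps)
    finally show ?case .
  qed
qed

theorem theorem1p3:
  shows "(\<forall>\<epsilon>>0. \<forall>\<^sub>F n in at_top. real (EG n 6 6) \<le> real n powr (1/3 + \<epsilon>)) \<and>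
         (\<forall>\<epsilon>>0. \<forall>\<^sub>F n in at_top. real (EG n 8 8) \<le> real n powr (1/4 + \<epsilon>))"
proof (intro conjI allI impI)
  let ?C = "\<lambda>a. a * (3 * a * 3 ^ a) ^ a"
  fix \<epsilon> :: real assume \<epsilon>: "0 < \<epsilon>"
  \<comment> \<open>Here 10 is \<open>3 * 3 + 1\<close> and, further down, 13 is
    \<open>3 * 4 + 1\<close>: the factor \<open>3 * CARD('n) + 1\<close> of \<open>EG_le\<close> in
    dimensions three and four.\<close>
  have "EG n 6 6 \<le> ?C a * s ^ (4 * a) * (10 * 2 ^ k)"
    if "1 \<le> a" "1 \<le> s" "1 \<le> k" "n \<le> s ^ (a * a)" "n \<le> (2 ^ k - 1) * (2 ^ k) ^ (3 - 1)" for a s k n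
    using EG_le[OF card_gf_pow2(1) zero_in_gf_pow2 gf_pow2_closed _ _ _ has_tree_colouring_8, where 'n = 3, of k n s a] that
    by (simp add: card_gf_pow2)
  from eventually_le_powr[where d = 3, OF _ this \<epsilon>]
  show "\<forall>\<^sub>F n in at_top. real (EG n 6 6) \<le> real n powr (1/3 + \<epsilon>)" by simp
  have "EG n 8 8 \<le> ?C a * s ^ (4 * a) * (13 * 2 ^ k)"
    if "1 \<le> a" "1 \<le> s" "1 \<le> k" "n \<le> s ^ (a * a)" "n \<le> (2 ^ k - 1) * (2 ^ k) ^ (4 - 1)" for a s k n
    using EG_le[OF card_gf_pow2(1) zero_in_gf_pow2 gf_pow2_closed _ _ _ has_tree_colouring_8, where 'n = 4, of k n s a] that
    by (simp add: card_gf_pow2)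
  from eventually_le_powr[where d = 4, OF _ this \<epsilon>]
  show "\<forall>\<^sub>F n in at_top. real (EG n 8 8) \<le> real n powr (1/4 + \<epsilon>)" by simp
qed

end
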